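(* Let $(P,\times,\star)$ be a strong projection algebra. Then the chain semigroup $\mathbf S(\mathscr C(P))$ is a projection-generated DRC-restriction semigroup with projection algebra $P(\mathbf S(\mathscr C(P)))=\{[p]\mid p\in P\}$. Conversely, if $(S,\cdot,{}^+,{}^\ast)$ is a projection-generated DRC-restriction semigroup whose projection algebra is $(P,\times,\star)$, then there exists a surjective $(2,1,1)$-homomorphism $\phi$ from $\mathbf S(\mathscr C(P))$ onto $S$ such that $[p]\phi=p$ for all $p\in P$.
   Context: Maps are written on the right. **DRC-restriction semigroups.** A DRC semigroup is a semigroup $(S,\cdot)$ with two unary operations ${}^+,{}^\ast$ such that for all $x,y\in S$: $x^+x=x$, $(xy)^+=(xy^+)^+$, $(xy)^+=x^+(xy)^+x^+$, $x^{++}=x^+$, $x^{+\ast}=x^+$; and $xx^\ast=x$, $(xy)^\ast=(x^\ast y)^\ast$, $(xy)^\ast=y^\ast(xy)^\ast y^\ast$, $x^{\ast\ast}=x^\ast$, $x^{\ast+}=x^\ast$. It is DRC-restriction if moreover $x(yx)^\ast=(yx^+)^\ast x$ and $(xy)^+x=x(x^\ast y)^+$ for all $x,y$. Its set of projections is $P(S)=\{x^+:x\in S\}=\{x^\ast:x\in S\}$, and its projection algebra is $(P(S),\times_S,\star_S)$ with $e\times_S f=(ef)^+$, $e\star_S f=(ef)^\ast$. $S$ is projection-generated if it is generated as a semigroup by $P(S)$. A $(2,1,1)$-homomorphism preserves $\cdot$, ${}^+$ and ${}^\ast$. **Projection algebras.** A projection algebra $(P,\times,\star)$ is a nonempty set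 with two binary operations such that for all $e,f,g\in P$: (L1) $e\times e=e$; (L2) $(e\times f)\times e=e\times f$; (L3) $e\times(f\times g)=(e\times f)\times(f\times g)$; (L4) $(e\times f)\times g=(e\times f)\times(e\times g)$; (R1) $e\star e=e$; (R2) $f\star e=e\star(f\star e)$; (R3) $(g\star f)\star e=(g\star f)\star(f\star e)$; (R4) $g\star(f\star e)=(g\star e)\star(f\star e)$; (P3) $(e\star(f\times g))\star g=(e\star f)\star g$ and $g\times((g\star f)\times e)=g\times(f\times e)$; (P4) $(e\times f)\star e=e\times f$ and $f\times(e\star f)=e\star f$. It is strong if moreover $e\times(((e\times f)\times g)\star f)=(e\times f)\times g$ and $(f\times(g\star(f\star e)))\star e=g\star(f\star e)$ for all $e,f,g$. Write $p\,\mathcal F_P\,q$ iff $p\times q=p$ and $p\star q=q$. **Chain semigroup.** Let $P$ be a strong projection algebra. A $P$-path is a tuple $(p_1,\dots,p_k)$, $k\geq1$, $p_i\in P$, with $p_1\,\mathcal F_P\,p_2\,\mathcal F_P\cdots\mathcal F_P\,p_k$; the set of $P$-paths is $\mathscr P(P)$, and $p\in P$ is identified with the path $(p)$. Put $\mathbf d(p_1,\dots,p_k)=p_1$, $\mathbf r(p_1,\dots,p_k)=p_k$, and $(p_1,\dots,p_k)\circ(q_1,\dots,q_l)=(p_1,\dots,p_k,q_2,\dots,q_l)$ when $p_k=q_1$. A triple $(e,p,f)\in P^3$ is admissible if $f=(e\star p)\star f$ and $e=e\times(p\times f)$; then $(e,e\star p,f)$ and $(e,p\times f,f)$ are $P$-paths.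 Let $\approx_P$ be the least equivalence relation on $\mathscr P(P)$ that relates only paths with the same $\mathbf d$ and the same $\mathbf r$, is compatible with $\circ$ on the left and on the right, and contains all pairs $((p,p),p)$ $(p\in P)$ and $((e,e\star p,f),(e,p\times f,f))$ ($(e,p,f)$ admissible). Write $[p_1,\dots,p_k]$ for the $\approx_P$-class of $(p_1,\dots,p_k)$, and $\mathscr C(P)=\mathscr P(P)/{\approx_P}$. The chain semigroup $\mathbf S(\mathscr C(P))$ is the set $\mathscr C(P)$ with the (well-defined) operations $[p_1,\dots,p_k]^+=[p_1]$, $[p_1,\dots,p_k]^\ast=[p_k]$ and $[p_1,\dots,p_k]\bullet[q_1,\dots,q_l]=[p_1',\dots,p_k',q_1',\dots,q_l']$, where $p_k'=p_k\times q_1$, $p_i'=p_i\times p_{i+1}'$ for $i=k-1,\dots,1$, $q_1'=p_k\star q_1$, and $q_j'=q_{j-1}'\star q_j$ for $j=2,\dots,l$. *)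

theory Defs
  imports "HOL-Algebra.Congruence"
begin

record 'a drc_struct = "'a partial_object" +
  mult :: "'a \<Rightarrow> 'a \<Rightarrow> 'a" (infixl \<open>\<cdot>\<index>\<close> 70)
  plus_op :: "'a \<Rightarrow> 'a" (\<open>_\<^sup>\<oplus>\<index>\<close> [1000] 1000)
  star_op :: "'a \<Rightarrow> 'a" (\<open>_\<^sup>\<star>\<index>\<close> [1000] 1000)

locale drc_semigroup =
  fixes S :: "'a drc_struct" (structure)
  assumes mult_closed: "x \<in> carrier S \<Longrightarrow> y \<in> carrier S \<Longrightarrow> x \<cdot> y \<in> carrier S"
    and plus_closed: "x \<in> carrier S \<Longrightarrow> x\<^sup>\<oplus> \<in> carrier S"
    and star_closed: "x \<in> carrier S \<Longrightarrow> x\<^sup>\<star> \<in> carrier S"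
    and mult_assoc: "x \<in> carrier S \<Longrightarrow> y \<in> carrier S \<Longrightarrow> z \<in> carrier S
      \<Longrightarrow> (x \<cdot> y) \<cdot> z = x \<cdot> (y \<cdot> z)"
    and plus_mult: "x \<in> carrier S \<Longrightarrow> x\<^sup>\<oplus> \<cdot> x = x"
    and plus_right: "x \<in> carrier S \<Longrightarrow> y \<in> carrier S \<Longrightarrow> (x \<cdot> y)\<^sup>\<oplus> = (x \<cdot> y\<^sup>\<oplus>)\<^sup>\<oplus>"
    and plus_absorb: "x \<in> carrier S \<Longrightarrow> y \<in> carrier S \<Longrightarrow> (x \<cdot> y)\<^sup>\<oplus> = x\<^sup>\<oplus> \<cdot> (x \<cdot> y)\<^sup>\<oplus> \<cdot> x\<^sup>\<oplus>"
    and plus_plus: "x \<in> carrier S \<Longrightarrow> (x\<^sup>\<oplus>)\<^sup>\<oplus> = x\<^sup>\<oplus>"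
    and plus_star: "x \<in> carrier S \<Longrightarrow> (x\<^sup>\<oplus>)\<^sup>\<star> = x\<^sup>\<oplus>"
    and mult_star: "x \<in> carrier S \<Longrightarrow> x \<cdot> x\<^sup>\<star> = x"
    and star_left: "x \<in> carrier S \<Longrightarrow> y \<in> carrier S \<Longrightarrow> (x \<cdot> y)\<^sup>\<star> = (x\<^sup>\<star> \<cdot> y)\<^sup>\<star>"
    and star_absorb: "x \<in> carrier S \<Longrightarrow> y \<in> carrier S \<Longrightarrow> (x \<cdot> y)\<^sup>\<star> = y\<^sup>\<star> \<cdot> (x \<cdot> y)\<^sup>\<star> \<cdot> y\<^sup>\<star>"
    and star_star: "x \<in> carrier S \<Longrightarrow> (x\<^sup>\<star>)\<^sup>\<star> = x\<^sup>\<star>"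
    and star_plus: "x \<in> carrier S \<Longrightarrow> (x\<^sup>\<star>)\<^sup>\<oplus> = x\<^sup>\<star>"

locale drc_restriction_semigroup = drc_semigroup +
  assumes restr_star: "x \<in> carrier S \<Longrightarrow> y \<in> carrier S \<Longrightarrow> x \<cdot> (y \<cdot> x)\<^sup>\<star> = (y \<cdot> x\<^sup>\<oplus>)\<^sup>\<star> \<cdot> x"
    and restr_plus: "x \<in> carrier S \<Longrightarrow> y \<in> carrier S \<Longrightarrow> (x \<cdot> y)\<^sup>\<oplus> \<cdot> x = x \<cdot> (x\<^sup>\<star> \<cdot> y)\<^sup>\<oplus>"

text \<open>In a DRC semigroup this also equals the image of the carrier under \<open>star_op\<close>.\<close>

definition projections :: "'a drc_struct \<Rightarrow> 'a set" where
  "projections S = plus_op S ` carrier S"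

inductive_set generated_subsemigroup :: "'a drc_struct \<Rightarrow> 'a set \<Rightarrow> 'a set"
  for S :: "'a drc_struct" and A :: "'a set" where
  incl: "x \<in> A \<Longrightarrow> x \<in> generated_subsemigroup S A"
| mult: "x \<in> generated_subsemigroup S A \<Longrightarrow> y \<in> generated_subsemigroup S A
    \<Longrightarrow> x \<cdot>\<^bsub>S\<^esub> y \<in> generated_subsemigroup S A"

definition projection_generated :: "'a drc_struct \<Rightarrow> bool" where
  "projection_generated S \<longleftrightarrow> generated_subsemigroup S (projections S) = carrier S"

definition drc_hom :: "'a drc_struct \<Rightarrow> 'b drc_struct \<Rightarrow> ('a \<Rightarrow> 'b) set" where
  "drc_hom S T = {h. (\<forall>x \<in> carrier S. h x \<in> carrier T)
     \<and> (\<forall>x \<in> carrier S. \<forall>y \<in> carrier S. h (x \<cdot>\<^bsub>S\<^esub> y) = h x \<cdot>\<^bsub>T\<^esub> h y)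
     \<and> (\<forall>x \<in> carrier S. h (x\<^sup>\<oplus>\<^bsub>S\<^esub>) = (h x)\<^sup>\<oplus>\<^bsub>T\<^esub>)
     \<and> (\<forall>x \<in> carrier S. h (x\<^sup>\<star>\<^bsub>S\<^esub>) = (h x)\<^sup>\<star>\<^bsub>T\<^esub>)}"

record 'a proj_struct = "'a partial_object" +
  ptimes :: "'a \<Rightarrow> 'a \<Rightarrow> 'a" (infixl \<open>\<otimes>\<index>\<close> 70)
  pstar :: "'a \<Rightarrow> 'a \<Rightarrow> 'a" (infixl \<open>\<star>\<index>\<close> 70)

locale projection_algebra =
  fixes P :: "'a proj_struct" (structure)
  assumes nonempty: "carrier P \<noteq> {}"
    and ptimes_closed: "e \<in> carrier P \<Longrightarrow> f \<in> carrier P \<Longrightarrow> e \<otimes> f \<in> carrier P"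
    and pstar_closed: "e \<in> carrier P \<Longrightarrow> f \<in> carrier P \<Longrightarrow> e \<star> f \<in> carrier P"
    and L1: "e \<in> carrier P \<Longrightarrow> e \<otimes> e = e"
    and L2: "e \<in> carrier P \<Longrightarrow> f \<in> carrier P \<Longrightarrow> (e \<otimes> f) \<otimes> e = e \<otimes> f"
    and L3: "e \<in> carrier P \<Longrightarrow> f \<in> carrier P \<Longrightarrow> g \<in> carrier P
      \<Longrightarrow> e \<otimes> (f \<otimes> g) = (e \<otimes> f) \<otimes> (f \<otimes> g)"
    and L4: "e \<in> carrier P \<Longrightarrow> f \<in> carrier P \<Longrightarrow> g \<in> carrier P
      \<Longrightarrow> (e \<otimes> f) \<otimes> g = (e \<otimes> f) \<otimes> (e \<otimes> g)"
    and R1: "e \<in> carrier P \<Longrightarrow> e \<star> e = e"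
    and R2: "e \<in> carrier P \<Longrightarrow> f \<in> carrier P \<Longrightarrow> f \<star> e = e \<star> (f \<star> e)"
    and R3: "e \<in> carrier P \<Longrightarrow> f \<in> carrier P \<Longrightarrow> g \<in> carrier P
      \<Longrightarrow> (g \<star> f) \<star> e = (g \<star> f) \<star> (f \<star> e)"
    and R4: "e \<in> carrier P \<Longrightarrow> f \<in> carrier P \<Longrightarrow> g \<in> carrier P
      \<Longrightarrow> g \<star> (f \<star> e) = (g \<star> e) \<star> (f \<star> e)"
    and P3_star: "e \<in> carrier P \<Longrightarrow> f \<in> carrier P \<Longrightarrow> g \<in> carrier P
      \<Longrightarrow> (e \<star> (f \<otimes> g)) \<star> g = (e \<star> f) \<star> g"
    and P3_times: "e \<in> carrier P \<Longrightarrow> f \<in> carrier P \<Longrightarrow> g \<in> carrier P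
      \<Longrightarrow> g \<otimes> ((g \<star> f) \<otimes> e) = g \<otimes> (f \<otimes> e)"
    and P4_star: "e \<in> carrier P \<Longrightarrow> f \<in> carrier P \<Longrightarrow> (e \<otimes> f) \<star> e = e \<otimes> f"
    and P4_times: "e \<in> carrier P \<Longrightarrow> f \<in> carrier P \<Longrightarrow> f \<otimes> (e \<star> f) = e \<star> f"

locale strong_projection_algebra = projection_algebra +
  assumes strong_times: "e \<in> carrier P \<Longrightarrow> f \<in> carrier P \<Longrightarrow> g \<in> carrier P
      \<Longrightarrow> e \<otimes> (((e \<otimes> f) \<otimes> g) \<star> f) = (e \<otimes> f) \<otimes> g"
    and strong_star: "e \<in> carrier P \<Longrightarrow> f \<in> carrier P \<Longrightarrow> g \<in> carrier P
      \<Longrightarrow> (f \<otimes> (g \<star> (f \<star> e))) \<star> e = g \<star> (f \<star> e)"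

text \<open>\<open>S\<close> has projection algebra \<open>P\<close>. The operations are only compared on the carrier:
  record equality would also constrain their meaningless values outside of it.\<close>

definition has_projection_algebra :: "'a drc_struct \<Rightarrow> 'a proj_struct \<Rightarrow> bool" where
  "has_projection_algebra S P \<longleftrightarrow> projections S = carrier P
     \<and> (\<forall>e \<in> carrier P. \<forall>f \<in> carrier P. e \<otimes>\<^bsub>P\<^esub> f = (e \<cdot>\<^bsub>S\<^esub> f)\<^sup>\<oplus>\<^bsub>S\<^esub>)
     \<and> (\<forall>e \<in> carrier P. \<forall>f \<in> carrier P. e \<star>\<^bsub>P\<^esub> f = (e \<cdot>\<^bsub>S\<^esub> f)\<^sup>\<star>\<^bsub>S\<^esub>)"

definition F_rel :: "'a proj_struct \<Rightarrow> 'a \<Rightarrow> 'a \<Rightarrow> bool" where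
  "F_rel P p q \<longleftrightarrow> p \<otimes>\<^bsub>P\<^esub> q = p \<and> p \<star>\<^bsub>P\<^esub> q = q"

text \<open>A path \<open>(p\<^sub>1, \<dots>, p\<^sub>k)\<close> is a nonempty list; its \<open>\<^bold>d\<close> and \<open>\<^bold>r\<close> are \<open>hd\<close> and \<open>last\<close>.\<close>

definition paths :: "'a proj_struct \<Rightarrow> 'a list set" where
  "paths P = {ps. ps \<noteq> [] \<and> set ps \<subseteq> carrier P \<and> successively (F_rel P) ps}"

text \<open>Only meaningful if \<open>last ps = hd qs\<close>.\<close>

definition path_comp :: "'a list \<Rightarrow> 'a list \<Rightarrow> 'a list" (infixl \<open>\<circ>\<^sub>p\<close> 70) where
  "ps \<circ>\<^sub>p qs = ps @ tl qs"

definition admissible :: "'a proj_struct \<Rightarrow> 'a \<Rightarrow> 'a \<Rightarrow> 'a \<Rightarrow> bool" where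
  "admissible P e p f \<longleftrightarrow> e \<in> carrier P \<and> p \<in> carrier P \<and> f \<in> carrier P
     \<and> f = (e \<star>\<^bsub>P\<^esub> p) \<star>\<^bsub>P\<^esub> f \<and> e = e \<otimes>\<^bsub>P\<^esub> (p \<otimes>\<^bsub>P\<^esub> f)"

definition path_congruence :: "'a proj_struct \<Rightarrow> ('a list \<times> 'a list) set \<Rightarrow> bool" where
  "path_congruence P R \<longleftrightarrow> equiv (paths P) R
     \<and> (\<forall>(ps, qs) \<in> R. hd ps = hd qs \<and> last ps = last qs)
     \<and> (\<forall>(ps, qs) \<in> R. \<forall>us \<in> paths P. last us = hd ps \<longrightarrow> (us \<circ>\<^sub>p ps, us \<circ>\<^sub>p qs) \<in> R)
     \<and> (\<forall>(ps, qs) \<in> R. \<forall>us \<in> paths P. last ps = hd us \<longrightarrow> (ps \<circ>\<^sub>p us, qs \<circ>\<^sub>p us) \<in> R)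
     \<and> (\<forall>p \<in> carrier P. ([p, p], [p]) \<in> R)
     \<and> (\<forall>e p f. admissible P e p f \<longrightarrow> ([e, e \<star>\<^bsub>P\<^esub> p, f], [e, p \<otimes>\<^bsub>P\<^esub> f, f]) \<in> R)"

text \<open>The least path congruence. For a strong projection algebra the family is nonempty: it contains
  the relation that identifies any two paths with the same endpoints.\<close>

definition path_equiv :: "'a proj_struct \<Rightarrow> ('a list \<times> 'a list) set" where
  "path_equiv P = \<Inter> {R. path_congruence P R}"

definition chain_class :: "'a proj_struct \<Rightarrow> 'a list \<Rightarrow> 'a list set" where
  "chain_class P ps = path_equiv P `` {ps}"

definition chains :: "'a proj_struct \<Rightarrow> 'a list set set" where
  "chains P = paths P // path_equiv P"

text \<open>\<open>left_restrict P [p\<^sub>1, \<dots>, p\<^sub>k] q = [p\<^sub>1', \<dots>, p\<^sub>k']\<close> with \<open>p\<^sub>k' = p\<^sub>k \<otimes> q\<close> and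
  \<open>p\<^sub>i' = p\<^sub>i \<otimes> p\<^sub>i\<^sub>+\<^sub>1'\<close>; the appended \<open>q\<close> is the head exactly for the last entry.\<close>

primrec left_restrict :: "'a proj_struct \<Rightarrow> 'a list \<Rightarrow> 'a \<Rightarrow> 'a list" where
  "left_restrict P [] q = []"
| "left_restrict P (p # ps) q =
     (p \<otimes>\<^bsub>P\<^esub> hd (left_restrict P ps q @ [q])) # left_restrict P ps q"

primrec right_restrict :: "'a proj_struct \<Rightarrow> 'a \<Rightarrow> 'a list \<Rightarrow> 'a list" where
  "right_restrict P p [] = []"
| "right_restrict P p (q # qs) = (p \<star>\<^bsub>P\<^esub> q) # right_restrict P (p \<star>\<^bsub>P\<^esub> q) qs"

definition path_mult :: "'a proj_struct \<Rightarrow> 'a list \<Rightarrow> 'a list \<Rightarrow> 'a list" where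
  "path_mult P ps qs = left_restrict P ps (hd qs) @ right_restrict P (last ps) qs"

text \<open>The operations are lifted to classes as in \<^theory>\<open>HOL.Equiv_Relations\<close>: the unions
  range over representatives, all of which yield the same class.\<close>

definition chain_semigroup :: "'a proj_struct \<Rightarrow> 'a list set drc_struct" where
  "chain_semigroup P = \<lparr>
     carrier = chains P,
     mult = (\<lambda>c d. \<Union>ps \<in> c. \<Union>qs \<in> d. chain_class P (path_mult P ps qs)),
     plus_op = (\<lambda>c. \<Union>ps \<in> c. chain_class P [hd ps]),
     star_op = (\<lambda>c. \<Union>ps \<in> c. chain_class P [last ps]) \<rparr>"

end

theory Submission
  imports Defs
begin

text \<open>Read \<open>p \<preceq> q\<close> (\<open>q \<otimes> p = p\<close>) as the order of projections. The strong axioms imply that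
  for related projections \<open>p\<close>, \<open>q\<close> (\<open>F_rel P p q\<close>) the maps \<open>x \<mapsto> x \<star> q\<close> and \<open>y \<mapsto> p \<otimes> y\<close> are
  mutually inverse bijections between the projections below \<open>p\<close> and those below \<open>q\<close>
  (\<open>F_restrict_right\<close>, \<open>F_restrict_left\<close>). So a path can be restricted to any projection below
  its first entry, or equally to one below its last entry, and each restriction is determined by
  either endpoint. Restriction maps the generating pairs of the path congruence to generating
  pairs, so it is defined on classes. The product of two paths with inner endpoints \<open>p\<close> and \<open>q\<close>
  is a composition: the first path restricted to end at \<open>p \<otimes> q\<close>, followed by the second one
  restricted to start at \<open>p \<star> q\<close>. Hence the product is well defined, its endpoints are those of
  restrictions, and the two restriction identities only say that restricting a path at its start
  or at the corresponding projection at its end gives the same path.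

  Associativity is the hard point. The two bracketings of a triple product agree outside the
  middle path. Inside they restrict it on both sides, but in different orders, and so start it at
  \<open>(p \<star> q\<^sub>1) \<otimes> t\<close> in one case and at \<open>p \<star> t\<close> in the other, where \<open>p\<close> is the end of the first path,
  \<open>q\<^sub>1\<close> the start of the middle one, and \<open>t\<close> its start after it is restricted by the third path
  alone. For a middle path with a single entry \<open>q\<close>, these are the two sides of the generating pair
  of an admissible triple with middle projection \<open>q\<close> (\<open>triple_admissible\<close>). For a longer path the
  two rows of entries form a ladder, whose squares commute by two such triples each
  (\<open>restrict_exchange\<close>); the two ends of the ladder are attached by one more triple each
  (\<open>path_mult_assoc\<close>).

  For the converse, send a path to the product of its entries in \<open>S\<close>. In \<open>S\<close> one has
  \<open>p q = (p \<otimes> q) q = p (p \<star> q)\<close>. This makes both sides of a generating pair equal to \<open>e p f\<close>, and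
  allows the entries of a product of words to be replaced by those of the restricted paths, which
  gives a homomorphism. Its image contains the projections, which generate \<open>S\<close>.\<close>

section \<open>The order of projections\<close>

lemma (in projection_algebra) times_times_left:
  assumes "e \<in> carrier P" "f \<in> carrier P"
  shows "e \<otimes> (e \<otimes> f) = e \<otimes> f"
  using L4[of e e f] L1 assms by simp

context strong_projection_algebra
begin

declare ptimes_closed [simp, intro] pstar_closed [simp, intro]

definition below :: "'a \<Rightarrow> 'a \<Rightarrow> bool" (infix \<open>\<preceq>\<close> 50) where
  "p \<preceq> q \<longleftrightarrow> p \<in> carrier P \<and> q \<in> carrier P \<and> q \<otimes> p = p"

lemma belowD:
  assumes "p \<preceq> q"
  shows "p \<in> carrier P" "q \<in> carrier P" "q \<otimes> p = p" "p \<otimes> q = p" "p \<star> q = p" "q \<star> p = p"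
proof -
  show c: "p \<in> carrier P" "q \<in> carrier P" "q \<otimes> p = p"
    using assms by (auto simp: below_def)
  show "p \<otimes> q = p" using L2[of q p] c by simp
  show "p \<star> q = p" using P4_star[of q p] c by simp
  then show "q \<star> p = p" using R2[of q p] c by metis
qed

lemma below_times [simp, intro]:
  "e \<in> carrier P \<Longrightarrow> f \<in> carrier P \<Longrightarrow> e \<otimes> f \<preceq> e"
  by (simp add: below_def times_times_left)

lemma below_star [simp, intro]:
  "e \<in> carrier P \<Longrightarrow> f \<in> carrier P \<Longrightarrow> e \<star> f \<preceq> f"
  by (simp add: below_def P4_times)

lemma below_refl [simp]: "e \<in> carrier P \<Longrightarrow> e \<preceq> e"
  by (simp add: below_def L1)

lemma below_trans [trans]:
  assumes "p \<preceq> q" "q \<preceq> r"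
  shows "p \<preceq> r"
  using L3[of r q p] belowD[OF assms(1)] belowD[OF assms(2)] by (simp add: below_def)

text \<open>In a semigroup this is \<open>(e (e f)\<^sup>*)\<^sup>+ = (e f)\<^sup>+\<close>: multiplying by \<open>(e f)\<^sup>*\<close> instead of \<open>f\<close> does not
  change \<open>e f\<close>.\<close>

lemma times_star_absorb:
  assumes "e \<in> carrier P" "f \<in> carrier P"
  shows "e \<otimes> (e \<star> f) = e \<otimes> f"
  using P3_times[of f f e] belowD(4)[OF below_star] assms by (simp add: L1)

lemma star_times_absorb:
  assumes "e \<in> carrier P" "f \<in> carrier P"
  shows "(e \<otimes> f) \<star> f = e \<star> f"
  using P3_star[of e e f] belowD(6)[OF below_times] assms by (simp add: R1)

text \<open>The next four lemmas are the sided absorption laws that make operations with a projection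
  blind to an intermediate larger one; they are the working form of (L3), (L4), (R3), (R4).\<close>

lemma below_star_left: "x \<preceq> p \<Longrightarrow> q \<in> carrier P \<Longrightarrow> x \<star> (p \<star> q) = x \<star> q"
  using R3[of q p x] belowD[of x p] by simp

lemma below_times_right: "y \<preceq> q \<Longrightarrow> p \<in> carrier P \<Longrightarrow> (p \<otimes> q) \<otimes> y = p \<otimes> y"
  using L3[of p q y] belowD[of y q] by simp

lemma star_below_right: "y \<preceq> q \<Longrightarrow> p \<in> carrier P \<Longrightarrow> (p \<star> q) \<star> y = p \<star> y"
  using R4[of q y p] belowD[of y q] by simp

lemma times_below_left: "x \<preceq> p \<Longrightarrow> q \<in> carrier P \<Longrightarrow> x \<otimes> (p \<otimes> q) = x \<otimes> q"
  using L4[of p x q] belowD[of x p] by simp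

lemma times_mono_right:
  assumes "y \<preceq> z" "p \<in> carrier P"
  shows "p \<otimes> y \<preceq> p \<otimes> z"
proof -
  have "(p \<otimes> z) \<otimes> (p \<otimes> y) = (p \<otimes> z) \<otimes> y"
    by (rule L4[symmetric]) (use belowD[OF assms(1)] assms(2) in auto)
  also have "\<dots> = p \<otimes> y" by (rule below_times_right[OF assms])
  finally show ?thesis using belowD(1,2)[OF assms(1)] assms(2) by (simp add: below_def)
qed

lemma star_mono_left: 
  assumes "x \<preceq> z" "p \<in> carrier P" shows "x \<star> p \<preceq> z \<star> p"
proof -
  have "x \<star> (z \<star> p) = x \<star> p" by (rule below_star_left[OF assms])
  moreover have "x \<star> (z \<star> p) \<preceq> z \<star> p" using assms belowD[of x z] by simp
  ultimately show ?thesis by simp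
qed

lemma star_star_left: "e \<in> carrier P \<Longrightarrow> f \<in> carrier P \<Longrightarrow> e \<star> (e \<star> f) = e \<star> f"
  by (rule below_star_left) auto

lemma F_refl: "p \<in> carrier P \<Longrightarrow> F_rel P p p"
  by (simp add: F_rel_def L1 R1)

text \<open>These are the links that a product of two paths inserts between its factors.\<close>

lemma F_product:
  assumes "e \<in> carrier P" "f \<in> carrier P"
  shows "F_rel P (e \<otimes> f) (e \<star> f)"
proof -
  have "(e \<otimes> f) \<otimes> (e \<star> f) = e \<otimes> f"
    using below_times_right[of "e \<star> f" f e] assms by (simp add: times_star_absorb)
  moreover have "(e \<otimes> f) \<star> (e \<star> f) = e \<star> f"
    using below_star_left[of "e \<otimes> f" e f] assms by (simp add: star_times_absorb)
  ultimately show ?thesis by (simp add: F_rel_def)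
qed

text \<open>A link \<open>(p, q)\<close> restricts to \<open>(x, x \<star> q)\<close>. The second part, which recovers \<open>x\<close> from the new
  right end, is where the strong axiom enters; the next lemma is the mirror image.\<close>

lemma F_restrict_right:
  assumes "F_rel P p q" "x \<preceq> p" "q \<in> carrier P"
  shows "F_rel P x (x \<star> q)" "p \<otimes> (x \<star> q) = x"
proof -
  have F: "p \<otimes> q = p" "p \<star> q = q" using assms by (auto simp: F_rel_def)
  note x = belowD[OF assms(2)]
  have "x \<otimes> q = x" using times_below_left[OF assms(2,3)] F x by simp
  then show "F_rel P x (x \<star> q)" using F_product[of x q] x assms by simp
  show "p \<otimes> (x \<star> q) = x" using strong_times[of p q x] F x assms by simp
qed

lemma F_restrict_left:
  assumes "F_rel P p q" "y \<preceq> q" "p \<in> carrier P"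
  shows "F_rel P (p \<otimes> y) y" "(p \<otimes> y) \<star> q = y"
proof -
  have F: "p \<otimes> q = p" "p \<star> q = q" using assms by (auto simp: F_rel_def)
  note y = belowD[OF assms(2)]
  have "p \<star> y = y" using star_below_right[OF assms(2,3)] F y by simp
  then show "F_rel P (p \<otimes> y) y" using F_product[of p y] y assms by simp
  show "(p \<otimes> y) \<star> q = y" using strong_star[of q p y] F y assms by simp
qed

text \<open>In a semigroup, \<open>e\<close> and \<open>f\<close> are \<open>(p q r)\<^sup>+\<close> and \<open>(p q r)\<^sup>*\<close>, and the two middle entries come
  from the bracketings \<open>(p q) r\<close> and \<open>p (q r)\<close>. Each middle entry is computed by transporting it
  along a link and back: \<open>p \<star> (q \<otimes> r)\<close> lies below the left end of the link
  \<open>(q \<otimes> r, q \<star> r)\<close> and is carried to \<open>f\<close>; dually \<open>(p \<star> q) \<otimes> r\<close> is carried to \<open>e\<close> by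
  \<open>(p \<otimes> q, p \<star> q)\<close>.\<close>

lemma triple_admissible:
  assumes c: "p \<in> carrier P" "q \<in> carrier P" "r \<in> carrier P"
  defines "e \<equiv> p \<otimes> (q \<otimes> r)" and "f \<equiv> (p \<star> q) \<star> r"
  shows "admissible P e q f" "e \<star> q = (p \<star> q) \<otimes> r" "q \<otimes> f = p \<star> (q \<otimes> r)"
proof -
  let ?x = "p \<star> (q \<otimes> r)" and ?y = "(p \<star> q) \<otimes> r"
  have ef: "e \<in> carrier P" "f \<in> carrier P" using c by (auto simp: e_def f_def)
  have x: "?x \<preceq> q \<otimes> r" "?x \<preceq> q" and y: "?y \<preceq> p \<star> q" "?y \<preceq> q"
    using c by (auto intro: below_trans)
  have "?x \<star> (q \<star> r) = f"
    using below_star_left[OF x(2), of r] P3_star[of p q r] c by (simp add: f_def)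
  then have "(q \<otimes> r) \<otimes> f = ?x"
    using F_restrict_right(2)[OF F_product x(1)] c by simp
  then show qf: "q \<otimes> f = ?x"
    using below_times_right[of f r q] c by (simp add: f_def)
  have "(p \<otimes> q) \<otimes> ?y = e"
    using below_times_right[OF y(2), of p] P3_times[of r q p] c by (simp add: e_def)
  then have "e \<star> (p \<star> q) = ?y"
    using F_restrict_left(2)[OF F_product y(1)] c by simp
  then show eq: "e \<star> q = ?y"
    using below_star_left[of e p q] c by (simp add: e_def)
  have "(e \<star> q) \<star> f = f"
    unfolding eq f_def using F_product[of "p \<star> q" r] c by (simp add: F_rel_def)
  moreover have "e \<otimes> (q \<otimes> f) = e"
    unfolding qf e_def using F_product[of p "q \<otimes> r"] c by (simp add: F_rel_def)
  ultimately show "admissible P e q f"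
    using c ef by (simp add: admissible_def)
qed

lemma below_antisym: "p \<preceq> q \<Longrightarrow> q \<preceq> p \<Longrightarrow> p = q"
  by (metis belowD(3,4))

text \<open>So both sides of a generating pair are paths. The middle entries are identified again by
  transport along the link at the other end.\<close>

lemma admissible_F:
  assumes "admissible P e p f"
  shows "F_rel P e (e \<star> p)" "F_rel P (e \<star> p) f" "F_rel P e (p \<otimes> f)" "F_rel P (p \<otimes> f) f"
proof -
  have c: "e \<in> carrier P" "p \<in> carrier P" "f \<in> carrier P"
    and f: "(e \<star> p) \<star> f = f" and e: "e \<otimes> (p \<otimes> f) = e"
    using assms by (auto simp: admissible_def)
  have "e \<preceq> e \<otimes> p" using times_mono_right[of "p \<otimes> f" p e] c e by simp
  then have "e \<otimes> p = e" using below_antisym c by blast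
  then show F1: "F_rel P e (e \<star> p)" using F_product[of e p] c by simp
  have "f \<preceq> p \<star> f" using star_mono_left[of "e \<star> p" p f] c f by simp
  then have "p \<star> f = f" using below_antisym c by blast
  then show F2: "F_rel P (p \<otimes> f) f" using F_product[of p f] c by simp
  have "(e \<star> (p \<otimes> f)) \<star> f = f" using P3_star[of e p f] c f by simp
  then have "e \<star> (p \<otimes> f) = p \<otimes> f"
    using F_restrict_right(2)[OF F2, of "e \<star> (p \<otimes> f)"] F2 c by (simp add: F_rel_def)
  then show "F_rel P e (p \<otimes> f)" using e by (simp add: F_rel_def)
  have "e \<otimes> ((e \<star> p) \<otimes> f) = e" using P3_times[of f p e] c e by simp
  then have "(e \<star> p) \<otimes> f = e \<star> p"
    using F_restrict_left(2)[OF F1, of "(e \<star> p) \<otimes> f"] F1 c by (simp add: F_rel_def)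
  then show "F_rel P (e \<star> p) f" using f by (simp add: F_rel_def)
qed

text \<open>A generating pair restricts to the generating pair of the triple with the same middle
  projection; this is why restriction respects the congruence.\<close>

lemma admissible_restrict:
  assumes "admissible P e p f" "e' \<preceq> e"
  defines "f' \<equiv> (e' \<star> p) \<star> f"
  shows "admissible P e' p f'" "e' \<star> (e \<star> p) = e' \<star> p" "e' \<star> (p \<otimes> f) = p \<otimes> f'"
    "(e' \<star> (p \<otimes> f)) \<star> f = f'"
proof -
  have c: "e \<in> carrier P" "p \<in> carrier P" "f \<in> carrier P"
    using assms by (auto simp: admissible_def)
  note e' = belowD[OF assms(2)]
  have f': "f' \<preceq> f" using c e' by (simp add: f'_def)
  show "e' \<star> (e \<star> p) = e' \<star> p" using below_star_left assms c by simp
  show l: "(e' \<star> (p \<otimes> f)) \<star> f = f'" using P3_star[of e' p f] c e' by (simp add: f'_def)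
  note F = admissible_F[OF assms(1)]
  have "(p \<otimes> f) \<otimes> f' = e' \<star> (p \<otimes> f)"
    using F_restrict_right(2)[OF F(4), of "e' \<star> (p \<otimes> f)"] l c e' by simp
  then show u: "e' \<star> (p \<otimes> f) = p \<otimes> f'" using below_times_right[OF f' c(2)] by simp
  have "F_rel P e' (p \<otimes> f')"
    using F_restrict_right(1)[OF F(3) assms(2)] c u by simp
  moreover have "(e' \<star> p) \<star> f' = f'"
    unfolding f'_def using star_star_left c e' by simp
  ultimately show "admissible P e' p f'"
    using c e' belowD(1)[OF f'] by (simp add: admissible_def F_rel_def)
qed

section \<open>The path congruence\<close>

lemma pathsD:
  assumes "ps \<in> paths P"
  shows "ps \<noteq> []" "hd ps \<in> carrier P" "last ps \<in> carrier P" "set ps \<subseteq> carrier P"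
  using assms by (auto simp: paths_def)

lemma paths_single [simp]: "[p] \<in> paths P \<longleftrightarrow> p \<in> carrier P"
  by (simp add: paths_def)

lemma paths_Cons:
  "qs \<noteq> [] \<Longrightarrow> p # qs \<in> paths P \<longleftrightarrow> p \<in> carrier P \<and> F_rel P p (hd qs) \<and> qs \<in> paths P"
  by (cases qs) (auto simp: paths_def)

lemma paths_append:
  "ps \<noteq> [] \<Longrightarrow> qs \<noteq> [] \<Longrightarrow> ps @ qs \<in> paths P
    \<longleftrightarrow> ps \<in> paths P \<and> qs \<in> paths P \<and> F_rel P (last ps) (hd qs)"
  by (auto simp: paths_def successively_append_iff)

lemma path_comp_paths:
  assumes "ps \<in> paths P" "qs \<in> paths P" "last ps = hd qs"
  shows "ps \<circ>\<^sub>p qs \<in> paths P" "hd (ps \<circ>\<^sub>p qs) = hd ps" "last (ps \<circ>\<^sub>p qs) = last qs"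
proof -
  obtain q qs' where q: "qs = q # qs'" using pathsD(1)[OF assms(2)] by (cases qs) auto
  show "ps \<circ>\<^sub>p qs \<in> paths P" "hd (ps \<circ>\<^sub>p qs) = hd ps" "last (ps \<circ>\<^sub>p qs) = last qs"
    using assms pathsD(1)[OF assms(1)] q
    by (cases "qs' = []"; simp add: path_comp_def paths_append paths_Cons)+
qed

lemma admissible_paths:
  assumes "admissible P e p f"
  shows "[e, e \<star> p, f] \<in> paths P" "[e, p \<otimes> f, f] \<in> paths P"
  using admissible_F[OF assms] assms by (auto simp: paths_Cons admissible_def)

lemma paths_dup: "p \<in> carrier P \<Longrightarrow> [p, p] \<in> paths P"
  by (simp add: paths_Cons F_refl)

lemma path_congruenceD:
  assumes "path_congruence P R"
  shows "equiv (paths P) R"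
    and "(ps, qs) \<in> R \<Longrightarrow> hd ps = hd qs" and "(ps, qs) \<in> R \<Longrightarrow> last ps = last qs"
    and "(ps, qs) \<in> R \<Longrightarrow> us \<in> paths P \<Longrightarrow> last us = hd ps \<Longrightarrow> (us \<circ>\<^sub>p ps, us \<circ>\<^sub>p qs) \<in> R"
    and "(ps, qs) \<in> R \<Longrightarrow> us \<in> paths P \<Longrightarrow> last ps = hd us \<Longrightarrow> (ps \<circ>\<^sub>p us, qs \<circ>\<^sub>p us) \<in> R"
    and "p \<in> carrier P \<Longrightarrow> ([p, p], [p]) \<in> R"
    and "admissible P e p f \<Longrightarrow> ([e, e \<star> p, f], [e, p \<otimes> f, f]) \<in> R"
  using assms unfolding path_congruence_def by blast+

lemma path_congruenceI:
  assumes "equiv (paths P) R"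
    and "\<And>ps qs. (ps, qs) \<in> R \<Longrightarrow> hd ps = hd qs \<and> last ps = last qs"
    and "\<And>ps qs us. (ps, qs) \<in> R \<Longrightarrow> us \<in> paths P \<Longrightarrow> last us = hd ps
      \<Longrightarrow> (us \<circ>\<^sub>p ps, us \<circ>\<^sub>p qs) \<in> R"
    and "\<And>ps qs us. (ps, qs) \<in> R \<Longrightarrow> us \<in> paths P \<Longrightarrow> last ps = hd us
      \<Longrightarrow> (ps \<circ>\<^sub>p us, qs \<circ>\<^sub>p us) \<in> R"
    and "\<And>p. p \<in> carrier P \<Longrightarrow> ([p, p], [p]) \<in> R"
    and "\<And>e p f. admissible P e p f \<Longrightarrow> ([e, e \<star> p, f], [e, p \<otimes> f, f]) \<in> R"
  shows "path_congruence P R"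
  using assms unfolding path_congruence_def by blast

text \<open>This makes the family of path congruences nonempty, so that the least one consists of pairs of
  paths.\<close>

lemma path_congruence_endpoints:
  "path_congruence P {(ps, qs). ps \<in> paths P \<and> qs \<in> paths P \<and> hd ps = hd qs \<and> last ps = last qs}"
  by (rule path_congruenceI)
    (auto simp: path_comp_paths admissible_paths paths_dup
      intro!: equivI refl_onI symI transI)

lemma path_congruence_path_equiv: "path_congruence P (path_equiv P)"
proof (rule path_congruenceI)
  show "equiv (paths P) (path_equiv P)"
  proof (rule equivI)
    show "path_equiv P \<subseteq> paths P \<times> paths P"
      using path_congruence_endpoints by (fastforce simp: path_equiv_def)
    show "refl_on (paths P) (path_equiv P)"
      by (rule refl_onI) (auto simp: path_equiv_def dest: path_congruenceD(1) equiv_class_self)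
    show "sym (path_equiv P)"
      by (rule symI) (fastforce simp: path_equiv_def equiv_def dest: path_congruenceD(1) symD)
    show "trans (path_equiv P)"
    proof (rule transI)
      fix x y z assume "(x, y) \<in> path_equiv P" "(y, z) \<in> path_equiv P"
      then show "(x, z) \<in> path_equiv P"
        unfolding path_equiv_def using path_congruenceD(1) by (auto simp: equiv_def dest: transD)
    qed
  qed
  show "hd ps = hd qs \<and> last ps = last qs" if "(ps, qs) \<in> path_equiv P" for ps qs
    using that path_congruence_endpoints by (force simp: path_equiv_def)
qed (auto simp: path_equiv_def dest: path_congruenceD)

text \<open>The induction principle for the congruence: a property of pairs holds on it once the pairs
  with that property form a path congruence.\<close>

lemma path_equiv_least: "path_congruence P R \<Longrightarrow> (ps, qs) \<in> path_equiv P \<Longrightarrow> (ps, qs) \<in> R"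
  by (auto simp: path_equiv_def)

definition path_eq :: "'a list \<Rightarrow> 'a list \<Rightarrow> bool" (infix \<open>\<approx>\<close> 50) where
  "ps \<approx> qs \<longleftrightarrow> (ps, qs) \<in> path_equiv P"

lemma equiv_path_equiv: "equiv (paths P) (path_equiv P)"
  by (rule path_congruenceD(1)[OF path_congruence_path_equiv])

lemma path_eq_refl: "ps \<in> paths P \<Longrightarrow> ps \<approx> ps"
  using equiv_path_equiv by (simp add: path_eq_def equiv_def refl_on_def)

lemma path_eq_sym: "ps \<approx> qs \<Longrightarrow> qs \<approx> ps"
  using equiv_path_equiv by (simp add: path_eq_def equiv_def symD)

lemma path_eq_trans [trans]: "ps \<approx> qs \<Longrightarrow> qs \<approx> rs \<Longrightarrow> ps \<approx> rs"
  unfolding path_eq_def using equiv_path_equiv by (meson equiv_def transD)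

lemma path_eq_paths:
  assumes "ps \<approx> qs"
  shows "ps \<in> paths P" "qs \<in> paths P"
  using equiv_path_equiv assms by (auto simp: path_eq_def equiv_def)

lemma path_eq_ends:
  assumes "ps \<approx> qs"
  shows "hd ps = hd qs" "last ps = last qs"
  using path_congruenceD(2,3)[OF path_congruence_path_equiv assms[unfolded path_eq_def]] .

lemma path_eq_comp:
  assumes "ps \<approx> ps'" "qs \<approx> qs'" "last ps = hd qs"
  shows "ps \<circ>\<^sub>p qs \<approx> ps' \<circ>\<^sub>p qs'"
proof -
  note c = path_congruenceD(4,5)[OF path_congruence_path_equiv, folded path_eq_def]
  have "ps \<circ>\<^sub>p qs \<approx> ps' \<circ>\<^sub>p qs"
    by (rule c(2)[OF assms(1) path_eq_paths(1)[OF assms(2)] assms(3)])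
  also have "ps' \<circ>\<^sub>p qs \<approx> ps' \<circ>\<^sub>p qs'"
    by (rule c(1)[OF assms(2) path_eq_paths(2)[OF assms(1)]])
      (simp add: assms(3) path_eq_ends(2)[OF assms(1), symmetric])
  finally show ?thesis .
qed

lemma path_eq_context:
  assumes "ps \<approx> qs" "us @ ps @ ws \<in> paths P"
  shows "us @ ps @ ws \<approx> us @ qs @ ws"
proof -
  note ne = pathsD(1)[OF path_eq_paths(1)[OF assms(1)]] pathsD(1)[OF path_eq_paths(2)[OF assms(1)]]
  have 1: "ps @ ws \<approx> qs @ ws"
  proof (cases "ws = []")
    case True with assms show ?thesis by simp
  next
    case False
    have "ps @ ws \<in> paths P" using assms False ne by (cases "us = []") (auto simp: paths_append)
    then have "last ps # ws \<in> paths P"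
      using False ne pathsD(3)[of ps] by (auto simp: paths_append paths_Cons)
    from path_eq_comp[OF assms(1) path_eq_refl[OF this]] show ?thesis
      by (simp add: path_comp_def)
  qed
  show ?thesis
  proof (cases "us = []")
    case True with 1 show ?thesis by simp
  next
    case False
    then have "us @ [hd ps] \<in> paths P"
      using assms(2) ne pathsD(2)[OF path_eq_paths(1)[OF assms(1)]]
      by (auto simp: paths_append simp del: append_assoc simp flip: append_assoc) 
        (auto simp: paths_append)
    from path_eq_comp[OF path_eq_refl[OF this] 1] show ?thesis
      using ne path_eq_ends[OF assms(1)] by (cases ps; cases qs; simp add: path_comp_def)
  qed
qed

lemma path_eq_dup: "p \<in> carrier P \<Longrightarrow> [p, p] \<approx> [p]"
  unfolding path_eq_def by (rule path_congruenceD(6)[OF path_congruence_path_equiv])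

lemma path_eq_admissible: "admissible P e p f \<Longrightarrow> [e, e \<star> p, f] \<approx> [e, p \<otimes> f, f]"
  unfolding path_eq_def by (rule path_congruenceD(7)[OF path_congruence_path_equiv])

lemma path_eq_triple:
  assumes "p \<in> carrier P" "q \<in> carrier P" "r \<in> carrier P"
  shows "[p \<otimes> (q \<otimes> r), (p \<star> q) \<otimes> r, (p \<star> q) \<star> r] \<approx> [p \<otimes> (q \<otimes> r), p \<star> (q \<otimes> r), (p \<star> q) \<star> r]"
  using path_eq_admissible[OF triple_admissible(1)[OF assms]] triple_admissible(2,3)[OF assms]
  by metis

section \<open>Restriction of paths\<close>

lemma left_restrict_Nil [simp]: "left_restrict P ps q = [] \<longleftrightarrow> ps = []"
  by (cases ps) auto

lemma right_restrict_Nil [simp]: "right_restrict P q ps = [] \<longleftrightarrow> ps = []"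
  by (cases ps) auto

lemma left_restrict_append:
  "left_restrict P (ps @ qs) q
    = left_restrict P ps (hd (left_restrict P qs q @ [q])) @ left_restrict P qs q"
  by (induction ps) (auto simp: hd_append)

lemma right_restrict_append:
  "ps \<noteq> [] \<Longrightarrow> right_restrict P q (ps @ qs)
    = right_restrict P q ps @ right_restrict P (last (right_restrict P q ps)) qs"
  by (induction ps arbitrary: q rule: list_nonempty_induct) auto

lemma last_left_restrict: "ps \<noteq> [] \<Longrightarrow> last (left_restrict P ps q) = last ps \<otimes> q"
  by (induction ps rule: list_nonempty_induct) auto

lemma hd_right_restrict: "qs \<noteq> [] \<Longrightarrow> hd (right_restrict P p qs) = p \<star> hd qs"
  by (cases qs) auto

lemma left_restrict_cong:
  "last ps \<otimes> q = last ps \<otimes> q' \<Longrightarrow> left_restrict P ps q = left_restrict P ps q'"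
  by (induction ps) (auto split: if_splits)

lemma right_restrict_cong:
  "p \<star> hd qs = p' \<star> hd qs \<Longrightarrow> right_restrict P p qs = right_restrict P p' qs"
  by (cases qs) auto

text \<open>The last part says that restricting at the end and restricting at the resulting start give
  the same path, since each link transports projections bijectively. The next lemma is the
  mirror image.\<close>

lemma left_restrict_path:
  assumes "ps \<in> paths P" "q \<in> carrier P"
  shows "left_restrict P ps q \<in> paths P \<and> hd (left_restrict P ps q) \<preceq> hd ps
    \<and> left_restrict P ps q = right_restrict P (hd (left_restrict P ps q)) ps"
  using assms
proof (induction ps)
  case Nil then show ?case by (simp add: paths_def)
next
  case (Cons p ps)
  show ?case
  proof (cases "ps = []")
    case True 
    with Cons show ?thesis using belowD(5)[OF below_times] by simp
  next
    case False
    have p: "p \<in> carrier P" "F_rel P p (hd ps)" "ps \<in> paths P"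
      using Cons.prems False by (auto simp: paths_Cons)
    let ?L = "left_restrict P ps q"
    from Cons.IH p Cons.prems have IH: "?L \<in> paths P" "hd ?L \<preceq> hd ps" "?L = right_restrict P (hd ?L) ps"
      by auto
    have c: "hd ?L \<in> carrier P" by (rule belowD(1)[OF IH(2)])
    note F = F_restrict_left[OF p(2) IH(2) p(1)]
    have eq: "left_restrict P (p # ps) q = (p \<otimes> hd ?L) # ?L"
      using False by (simp add: hd_append)
    have "(p \<otimes> hd ?L) \<star> p = p \<otimes> hd ?L" using belowD(5)[OF below_times] p c by simp
    moreover have "right_restrict P (p \<otimes> hd ?L) ps = right_restrict P (hd ?L) ps"
      by (rule right_restrict_cong) (use F belowD(5)[OF IH(2)] in simp)
    ultimately show ?thesis
      unfolding eq using IH F p c False by (simp add: paths_Cons)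
  qed
qed

lemma right_restrict_path:
  assumes "ps \<in> paths P" "q \<in> carrier P"
  shows "right_restrict P q ps \<in> paths P \<and> last (right_restrict P q ps) \<preceq> last ps
    \<and> right_restrict P q ps = left_restrict P ps (last (right_restrict P q ps))"
  using assms
proof (induction ps arbitrary: q)
  case Nil then show ?case by (simp add: paths_def)
next
  case (Cons p ps)
  show ?case
  proof (cases "ps = []")
    case True 
    with Cons show ?thesis using belowD(3)[OF below_star] by simp
  next
    case False
    have p: "p \<in> carrier P" "F_rel P p (hd ps)" "ps \<in> paths P"
      using Cons.prems False by (auto simp: paths_Cons)
    have qp: "q \<star> p \<in> carrier P" "q \<star> p \<preceq> p" using p Cons.prems by auto
    let ?R = "right_restrict P (q \<star> p) ps"
    from Cons.IH p qp have IH: "?R \<in> paths P" "last ?R \<preceq> last ps" "?R = left_restrict P ps (last ?R)"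
      by auto
    have hd: "hd ?R = (q \<star> p) \<star> hd ps" using False by (simp add: hd_right_restrict)
    note F = F_restrict_right[OF p(2) qp(2) pathsD(2)[OF p(3)]]
    have "left_restrict P (p # ps) (last ?R) = (p \<otimes> hd ?R) # ?R"
      using False IH(3) by (simp add: hd_append)
    moreover have "p \<otimes> hd ?R = q \<star> p" using F(2) hd by simp
    ultimately show ?thesis
      using IH F qp False hd by (simp add: paths_Cons)
  qed
qed

lemmas left_restrict_paths = left_restrict_path[THEN conjunct1]
  and left_restrict_below = left_restrict_path[THEN conjunct2, THEN conjunct1]
  and left_restrict_as_right = left_restrict_path[THEN conjunct2, THEN conjunct2]

lemmas right_restrict_paths = right_restrict_path[THEN conjunct1]
  and right_restrict_below = right_restrict_path[THEN conjunct2, THEN conjunct1]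
  and right_restrict_as_left = right_restrict_path[THEN conjunct2, THEN conjunct2]

text \<open>Stated with both parts because the second is the condition under which the composition on the
  right-hand side of the first is meaningful.\<close>

lemma right_restrict_comp:
  assumes "ps \<in> paths P" "us \<in> paths P" "last ps = hd us" "q \<in> carrier P"
  shows "right_restrict P q (ps \<circ>\<^sub>p us)
    = right_restrict P q ps \<circ>\<^sub>p right_restrict P (last (right_restrict P q ps)) us"
    and "hd (right_restrict P (last (right_restrict P q ps)) us) = last (right_restrict P q ps)"
proof -
  let ?l = "last (right_restrict P q ps)"
  obtain u us' where us: "us = u # us'" using pathsD(1)[OF assms(2)] by (cases us) auto
  have l: "?l \<star> u = ?l"
    using belowD(5)[OF right_restrict_below[OF assms(1,4)]] assms(3) us by simp
  show "hd (right_restrict P ?l us) = ?l" using l us by simp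
  show "right_restrict P q (ps \<circ>\<^sub>p us) = right_restrict P q ps \<circ>\<^sub>p right_restrict P ?l us"
    unfolding us path_comp_def
    using right_restrict_append[OF pathsD(1)[OF assms(1)]] l by simp
qed

lemma path_eq_right_restrict:
  assumes "ps \<approx> qs" "q \<in> carrier P"
  shows "right_restrict P q ps \<approx> right_restrict P q qs"
proof -
  let ?R = "{(ps, qs). ps \<approx> qs \<and> (\<forall>q \<in> carrier P. right_restrict P q ps \<approx> right_restrict P q qs)}"
  have "path_congruence P ?R"
  proof (rule path_congruenceI)
    show "equiv (paths P) ?R"
    proof (rule equivI)
      show "?R \<subseteq> paths P \<times> paths P" using path_eq_paths by auto
      show "refl_on (paths P) ?R"
        by (rule refl_onI) (simp add: path_eq_refl right_restrict_paths)
      show "sym ?R" by (rule symI) (simp add: path_eq_sym)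
      show "trans ?R" by (rule transI) (simp, meson path_eq_trans)
    qed
  next
    fix ps qs assume "(ps, qs) \<in> ?R"
    then show "hd ps = hd qs \<and> last ps = last qs" using path_eq_ends by auto
  next
    fix ps qs us assume *: "(ps, qs) \<in> ?R" and us: "us \<in> paths P" "last us = hd ps"
    then have ps: "ps \<in> paths P" "qs \<in> paths P" "last us = hd qs" and eq: "ps \<approx> qs"
      using path_eq_paths path_eq_ends by auto
    have "right_restrict P q (us \<circ>\<^sub>p ps) \<approx> right_restrict P q (us \<circ>\<^sub>p qs)" if "q \<in> carrier P" for q
    proof -
      let ?R = "right_restrict P q us"
      have R: "?R \<in> paths P" using right_restrict_paths us that by blast
      show ?thesis
        unfolding right_restrict_comp(1)[OF us(1) ps(1) us(2) that]
          right_restrict_comp(1)[OF us(1) ps(2,3) that]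
        by (rule path_eq_comp[OF path_eq_refl[OF R]])
          (use * pathsD(3)[OF R] right_restrict_comp(2)[OF us(1) ps(1) us(2) that] in simp_all)
    qed
    moreover have "us \<circ>\<^sub>p ps \<approx> us \<circ>\<^sub>p qs" using path_eq_comp path_eq_refl us eq by blast
    ultimately show "(us \<circ>\<^sub>p ps, us \<circ>\<^sub>p qs) \<in> ?R" by simp
  next
    fix ps qs us assume *: "(ps, qs) \<in> ?R" and us: "us \<in> paths P" "last ps = hd us"
    then have ps: "ps \<in> paths P" "qs \<in> paths P" "last qs = hd us" and eq: "ps \<approx> qs"
      using path_eq_paths path_eq_ends by auto
    have "right_restrict P q (ps \<circ>\<^sub>p us) \<approx> right_restrict P q (qs \<circ>\<^sub>p us)" if "q \<in> carrier P" for q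
    proof -
      have R: "right_restrict P q ps \<approx> right_restrict P q qs" using * that by blast
      let ?l = "last (right_restrict P q ps)"
      have l: "last (right_restrict P q qs) = ?l" using path_eq_ends(2)[OF R] by simp
      have "right_restrict P ?l us \<in> paths P"
        using right_restrict_paths us pathsD(3)[OF path_eq_paths(1)[OF R]] by blast
      then show ?thesis
        unfolding right_restrict_comp(1)[OF ps(1) us that] l
          right_restrict_comp(1)[OF ps(2) us(1) ps(3) that]
        by (intro path_eq_comp[OF R] path_eq_refl right_restrict_comp(2)[OF ps(1) us that, symmetric])
    qed
    moreover have "ps \<circ>\<^sub>p us \<approx> qs \<circ>\<^sub>p us" using path_eq_comp path_eq_refl us eq by blast
    ultimately show "(ps \<circ>\<^sub>p us, qs \<circ>\<^sub>p us) \<in> ?R" by simp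
  next
    fix p assume p: "p \<in> carrier P"
    have "right_restrict P q [p, p] = [q \<star> p, q \<star> p]" if "q \<in> carrier P" for q
      using p that belowD(5)[OF below_star] by simp
    with p show "([p, p], [p]) \<in> ?R" by (auto intro: path_eq_dup)
  next
    fix e p f assume a: "admissible P e p f"
    then have c: "e \<in> carrier P" by (simp add: admissible_def)
    have "right_restrict P q [e, e \<star> p, f] \<approx> right_restrict P q [e, p \<otimes> f, f]"
      if "q \<in> carrier P" for q
      using path_eq_admissible[OF admissible_restrict(1)[OF a, of "q \<star> e"]]
        admissible_restrict(2-4)[OF a, of "q \<star> e"] that c by simp
    then show "([e, e \<star> p, f], [e, p \<otimes> f, f]) \<in> ?R"
      using path_eq_admissible[OF a] by simp
  qed
  from path_equiv_least[OF this assms(1)[unfolded path_eq_def]] assms(2) show ?thesis by blast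
qed

text \<open>A left restriction of \<open>ps\<close> is the right restriction at its start \<open>r\<close>, for which the claim is
  already known; the two restrictions end in the same projection, so restricting \<open>qs\<close> at \<open>r\<close>
  is the left restriction of \<open>qs\<close> in question.\<close>

lemma path_eq_left_restrict:
  assumes "ps \<approx> qs" "q \<in> carrier P"
  shows "left_restrict P ps q \<approx> left_restrict P qs q"
proof -
  note ps = path_eq_paths[OF assms(1)]
  note c = pathsD[OF ps(1)] pathsD[OF ps(2)]
  let ?r = "hd (left_restrict P ps q)"
  have L: "left_restrict P ps q = right_restrict P ?r ps" and r: "?r \<in> carrier P"
    using left_restrict_as_right[OF ps(1) assms(2)] belowD(1)[OF left_restrict_below[OF ps(1) assms(2)]] .
  have eq: "right_restrict P ?r ps \<approx> right_restrict P ?r qs"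
    by (rule path_eq_right_restrict[OF assms(1) r])
  have "last (right_restrict P ?r qs) = last qs \<otimes> q"
    using path_eq_ends(2)[OF eq] path_eq_ends(2)[OF assms(1)] last_left_restrict[OF c(1), of q]
    unfolding L[symmetric] by simp
  then have "right_restrict P ?r qs = left_restrict P qs (last qs \<otimes> q)"
    using right_restrict_as_left[OF ps(2) r] by simp
  also have "\<dots> = left_restrict P qs q"
    by (rule left_restrict_cong) (use c assms(2) in \<open>simp add: times_times_left\<close>)
  finally show ?thesis using eq L by simp
qed

section \<open>The product of paths\<close>

lemma path_eq_append:
  assumes "ps \<approx> ps'" "qs \<approx> qs'" "ps @ qs \<in> paths P"
  shows "ps @ qs \<approx> ps' @ qs'"
proof -
  have "ps @ qs \<approx> ps' @ qs" using path_eq_context[OF assms(1), of "[]" qs] assms(3) by simp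
  also have "ps' @ qs \<approx> ps' @ qs'"
    using path_eq_context[OF assms(2), of ps' "[]"] path_eq_paths(2)[OF calculation] by simp
  finally show ?thesis .
qed

lemma path_mult_path:
  assumes "ps \<in> paths P" "qs \<in> paths P"
  shows "path_mult P ps qs \<in> paths P"
    "hd (path_mult P ps qs) = hd (left_restrict P ps (hd qs))"
    "last (path_mult P ps qs) = last (right_restrict P (last ps) qs)"
proof -
  note c = pathsD[OF assms(1)] pathsD[OF assms(2)]
  then show "path_mult P ps qs \<in> paths P"
    using left_restrict_paths[OF assms(1) c(6)] right_restrict_paths[OF assms(2) c(3)]
    by (simp add: path_mult_def paths_append last_left_restrict hd_right_restrict F_product)
  show "hd (path_mult P ps qs) = hd (left_restrict P ps (hd qs))"
    "last (path_mult P ps qs) = last (right_restrict P (last ps) qs)"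
    using c by (auto simp: path_mult_def)
qed

text \<open>The product depends on the inner endpoints only through restrictions, and equivalent paths
  have the same endpoints.\<close>

lemma path_eq_path_mult:
  assumes "ps \<approx> ps'" "qs \<approx> qs'"
  shows "path_mult P ps qs \<approx> path_mult P ps' qs'"
proof -
  note c = path_eq_paths[OF assms(1)] path_eq_paths[OF assms(2)]
  show ?thesis
    unfolding path_mult_def path_eq_ends[OF assms(1), symmetric] path_eq_ends[OF assms(2), symmetric]
    by (intro path_eq_append path_eq_left_restrict path_eq_right_restrict assms pathsD c
        path_mult_path(1)[OF c(1,3), unfolded path_mult_def])
qed

section \<open>Associativity\<close>

text \<open>The comparison of the first entries is needed to carry the induction along the path.\<close>

lemma left_restrict_twice:
  assumes "ps \<in> paths P" "t \<preceq> q"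
  shows "left_restrict P (left_restrict P ps q) t = left_restrict P ps t
    \<and> hd (left_restrict P ps t) \<preceq> hd (left_restrict P ps q)"
  using assms(1)
proof (induction ps)
  case Nil then show ?case by (simp add: paths_def)
next
  case (Cons p ps)
  let ?z = "hd (left_restrict P ps q @ [q])" and ?w = "hd (left_restrict P ps t @ [t])"
  have p: "p \<in> carrier P" using Cons.prems by (simp add: paths_def)
  have "?w \<preceq> ?z \<and> left_restrict P (left_restrict P ps q) t = left_restrict P ps t"
    using Cons assms(2) by (cases "ps = []") (auto simp: paths_Cons hd_append)
  then show ?case 
    using below_times_right[of ?w ?z p] times_mono_right[of ?w ?z p] p by simp
qed

lemma right_restrict_twice:
  assumes "x \<preceq> q" "qs \<in> paths P"
  shows "right_restrict P x (right_restrict P q qs) = right_restrict P x qs"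
  using assms
proof (induction qs arbitrary: x q)
  case Nil then show ?case by (simp add: paths_def)
next
  case (Cons p ps)
  have p: "p \<in> carrier P" using Cons.prems by (simp add: paths_def)
  have "ps = [] \<or> right_restrict P (x \<star> p) (right_restrict P (q \<star> p) ps) = right_restrict P (x \<star> p) ps"
    using Cons.IH[OF star_mono_left[OF Cons.prems(1) p]] Cons.prems
    by (cases "ps = []") (auto simp: paths_Cons)
  then show ?case
    using below_star_left[OF Cons.prems(1) p] by auto
qed

text \<open>The ladder. Write \<open>x\<^sub>i\<close> and \<open>y\<^sub>i\<close> for the entries of \<open>xs\<close> and \<open>ys\<close>. The path that follows the
  \<open>x\<^sub>i\<close> to the end and then steps to the last \<open>y\<^sub>i\<close> is deformed to the one that steps from \<open>x\<^sub>1\<close> to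
  \<open>y\<^sub>1\<close> at once. The induction moves the step down by one square at a time. The equation for \<open>hd xs\<close>
  identifies the corners of these squares; with the one for \<open>last ys\<close> it identifies the two ends
  of the ladder, where the neighbouring paths are attached.\<close>

lemma restrict_exchange:
  assumes "qs \<in> paths P" "p \<in> carrier P" "r \<in> carrier P"
  defines "xs \<equiv> left_restrict P (right_restrict P p qs) r"
    and "ys \<equiv> right_restrict P p (left_restrict P qs r)"
  shows "hd xs = (p \<star> hd qs) \<otimes> hd (left_restrict P qs r)
    \<and> last ys = last (right_restrict P p qs) \<star> (last qs \<otimes> r)
    \<and> xs @ [last ys] \<approx> hd xs # ys"
  using assms(1,2) unfolding xs_def ys_def
proof (induction qs arbitrary: p)
  case Nil then show ?case by (simp add: paths_def)
next
  case (Cons q qs)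
  show ?case
  proof (cases "qs = []")
    case True
    with Cons.prems assms(3) have "q \<in> carrier P" by simp
    moreover have "F_rel P ((p \<star> q) \<otimes> r) (p \<star> (q \<otimes> r))"
      using F_product[of "p \<star> q" "q \<otimes> r"] times_below_left[of "p \<star> q" q r]
        star_below_right[of "q \<otimes> r" q p] \<open>q \<in> carrier P\<close> Cons.prems(2) assms(3) by simp
    ultimately show ?thesis
      using True Cons.prems assms(3) star_below_right[OF below_times, of q r p]
        times_below_left[of "p \<star> q" q r]
      by (auto simp: intro!: path_eq_refl simp: paths_Cons)
  next
    case False
    have c: "q \<in> carrier P" "F_rel P q (hd qs)" "qs \<in> paths P"
      using Cons.prems False by (auto simp: paths_Cons)
    let ?a = "p \<star> q" and ?q' = "hd qs" and ?t' = "hd (left_restrict P qs r)"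
    let ?xs = "left_restrict P (right_restrict P ?a qs) r"
      and ?ys = "right_restrict P ?a (left_restrict P qs r)"
    have a: "?a \<in> carrier P" "?a \<preceq> q" using c Cons.prems by auto
    have q': "?q' \<in> carrier P" by (rule pathsD[OF c(3)])
    have t': "?t' \<preceq> ?q'" using left_restrict_below[OF c(3) assms(3)] .
    note t'c = belowD(1)[OF t']
    from Cons.IH[OF c(3) a(1)] have IH: "hd ?xs = (?a \<star> ?q') \<otimes> ?t'"
      "last ?ys = last (right_restrict P ?a qs) \<star> (last qs \<otimes> r)"
      "?xs @ [last ?ys] \<approx> hd ?xs # ?ys" by auto
    let ?y = "p \<star> (q \<otimes> ?t')"
    have t: "q \<otimes> ?t' \<preceq> q" using c t'c by simp
    \<comment> \<open>The first square has the corners \<open>?a \<otimes> ?t'\<close> and \<open>hd ?xs\<close> above, \<open>?y\<close> and \<open>?a \<star> ?t'\<close> below.\<close>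
    have x: "?a \<otimes> hd ?xs = ?a \<otimes> ?t'"
      using P3_times[of ?t' ?q' ?a] IH(1) a q' t'c belowD(3)[OF t'] by simp
    have x2: "?a \<otimes> ?t' = ?a \<otimes> (q \<otimes> ?t')"
      using times_below_left[OF a(2) t'c] by simp
    have y: "?y = ?a \<star> (q \<otimes> ?t')" using star_below_right[OF t] Cons.prems by simp
    have y': "?y \<star> ?t' = ?a \<star> ?t'"
      using P3_star[of p q ?t'] c t'c Cons.prems by simp
    have ys: "right_restrict P ?y (left_restrict P qs r) = ?ys"
      by (rule right_restrict_cong) (rule y')
    have hy: "hd ?ys = ?a \<star> ?t'" using False by (simp add: hd_right_restrict)
    have XS: "left_restrict P (right_restrict P p (q # qs)) r = (?a \<otimes> ?t') # ?xs"
      using False x by (simp add: hd_append)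
    have YS: "right_restrict P p (left_restrict P (q # qs) r) = ?y # ?ys"
      using False ys by (simp add: hd_append)
    have hq: "hd (left_restrict P (q # qs) r) = q \<otimes> ?t'" using False by (simp add: hd_append)
    \<comment> \<open>Both ways around the square reduce to its diagonal: the way along the top by the triple
      \<open>(?a, ?q', ?t')\<close>, the way along the bottom by the triple \<open>(?a, q, ?t')\<close>.\<close>
    have sq1: "[?a \<otimes> ?t', hd ?xs, ?a \<star> ?t'] \<approx> [?a \<otimes> ?t', ?a \<star> ?t', ?a \<star> ?t']"
      using path_eq_triple[OF a(1) q' t'c] belowD(3)[OF t'] star_below_right[OF t' a(1)] IH(1)
      by simp
    have sq2: "[?a \<otimes> ?t', ?a \<otimes> ?t', ?a \<star> ?t'] \<approx> [?a \<otimes> ?t', ?y, ?a \<star> ?t']"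
      using path_eq_triple[OF a(1) c(1) t'c] belowD(5)[OF a(2)] y x2 by simp
    have e: "?a \<otimes> ?t' \<in> carrier P" "?a \<star> ?t' \<in> carrier P" using a t'c by auto
    have "[?a \<otimes> ?t', hd ?xs, ?a \<star> ?t'] \<approx> [?a \<otimes> ?t', ?a \<star> ?t']"
      using path_eq_trans[OF sq1] path_eq_context[OF path_eq_dup[OF e(2)], of "[?a \<otimes> ?t']" "[]"]
        path_eq_paths(2)[OF sq1] by simp
    also have "\<dots> \<approx> [?a \<otimes> ?t', ?a \<otimes> ?t', ?a \<star> ?t']"
      using path_eq_context[OF path_eq_dup[OF e(1)], of "[]" "[?a \<star> ?t']"]
        path_eq_paths(1)[OF sq2] path_eq_sym by simp
    also note sq2
    finally have sq: "[?a \<otimes> ?t', hd ?xs, ?a \<star> ?t'] \<approx> [?a \<otimes> ?t', ?y, ?a \<star> ?t']" .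
    obtain ys' where ys': "?ys = (?a \<star> ?t') # ys'"
      using hy False by (cases ?ys) auto
    have "F_rel P (?a \<otimes> ?t') (hd ?xs)"
      using path_eq_paths(1)[OF sq1] by (simp add: paths_Cons)
    then have "(?a \<otimes> ?t') # ?xs @ [last ?ys] \<in> paths P"
      using path_eq_paths(1)[OF IH(3)] False e by (simp add: paths_Cons)
    then have "(?a \<otimes> ?t') # ?xs @ [last ?ys] \<approx> (?a \<otimes> ?t') # hd ?xs # ?ys"
      using path_eq_context[OF IH(3), of "[?a \<otimes> ?t']" "[]"] by simp
    also have "\<dots> \<approx> (?a \<otimes> ?t') # ?y # ?ys"
      using path_eq_context[OF sq, of "[]" ys'] path_eq_paths(2)[OF calculation] ys' by simp
    finally show ?thesis
      unfolding XS YS hq using False IH(2) x2 by simp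
  qed
qed

lemma path_mult_assoc:
  assumes "ps \<in> paths P" "qs \<in> paths P" "rs \<in> paths P"
  shows "path_mult P (path_mult P ps qs) rs \<approx> path_mult P ps (path_mult P qs rs)"
proof -
  note c = pathsD[OF assms(1)] pathsD[OF assms(2)] pathsD[OF assms(3)]
  let ?p = "last ps" and ?q = "hd qs" and ?l = "last qs" and ?r = "hd rs"
  let ?xs = "left_restrict P (right_restrict P ?p qs) ?r"
    and ?ys = "right_restrict P ?p (left_restrict P qs ?r)"
  let ?s = "last (right_restrict P ?p qs)" and ?t = "hd (left_restrict P qs ?r)"
  let ?A = "left_restrict P ps ?t" and ?W = "right_restrict P ?s rs"
  have q: "?q \<in> carrier P" "?l \<in> carrier P" "?p \<in> carrier P" "?r \<in> carrier P" using c by auto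
  have s: "?s \<preceq> ?l" and t: "?t \<preceq> ?q"
    using right_restrict_below[OF assms(2) q(3)] left_restrict_below[OF assms(2) q(4)] .
  note sc = belowD(1)[OF s] and tc = belowD(1)[OF t]
  from restrict_exchange[OF assms(2) q(3,4)]
  have hx: "hd ?xs = (?p \<star> ?q) \<otimes> ?t" and ly: "last ?ys = ?s \<star> (?l \<otimes> ?r)"
    and ex: "?xs @ [last ?ys] \<approx> hd ?xs # ?ys" by auto
  have lx: "last ?xs = ?s \<otimes> ?r" using c by (simp add: last_left_restrict)
  have hy: "hd ?ys = ?p \<star> ?t" using c by (simp add: hd_right_restrict)
  \<comment> \<open>Outside the middle path both bracketings give the same restrictions of \<open>ps\<close> and \<open>rs\<close>.\<close>
  have "hd ?xs \<preceq> ?q" unfolding hx by (rule below_trans[OF below_times below_star]) (use q tc in simp_all)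
  then have "left_restrict P (left_restrict P ps ?q) (hd ?xs) = left_restrict P ps (hd ?xs)"
    using left_restrict_twice[OF assms(1)] by simp
  also have "\<dots> = ?A"
    by (rule left_restrict_cong)
      (unfold hx P3_times[OF tc q(1,3)] belowD(3)[OF t], rule refl)
  finally have A: "left_restrict P (left_restrict P ps ?q) (hd ?xs) = ?A" .
  have "last ?ys \<preceq> ?l"
    unfolding ly by (rule below_trans[OF below_star below_times]) (use q sc in simp_all)
  then have "right_restrict P (last ?ys) (right_restrict P ?l rs) = right_restrict P (last ?ys) rs"
    by (rule right_restrict_twice[OF _ assms(3)])
  also have "\<dots> = ?W"
    by (rule right_restrict_cong) (unfold ly P3_star[OF sc q(2,4)] belowD(5)[OF s], rule refl)
  finally have W: "right_restrict P (last ?ys) (right_restrict P ?l rs) = ?W" .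
  have nL: "left_restrict P qs ?r \<noteq> []" using c by simp
  have ne: "?xs \<noteq> []" "?ys \<noteq> []" "?A \<noteq> []" "?W \<noteq> []" using c by auto
  have "path_mult P (path_mult P ps qs) rs = left_restrict P (path_mult P ps qs) ?r @ ?W"
    unfolding path_mult_def[of P "path_mult P ps qs" rs] path_mult_path(3)[OF assms(1,2)] ..
  also have "left_restrict P (path_mult P ps qs) ?r = ?A @ ?xs"
    unfolding path_mult_def left_restrict_append hd_append2[OF ne(1)] A ..
  finally have left: "path_mult P (path_mult P ps qs) rs = ?A @ ?xs @ ?W" by simp
  have "path_mult P ps (path_mult P qs rs) = ?A @ right_restrict P ?p (path_mult P qs rs)"
    unfolding path_mult_def[of P ps "path_mult P qs rs"] path_mult_path(2)[OF assms(2,3)] ..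
  also have "right_restrict P ?p (path_mult P qs rs) = ?ys @ ?W"
    unfolding path_mult_def right_restrict_append[OF nL] W ..
  finally have right: "path_mult P ps (path_mult P qs rs) = ?A @ ?ys @ ?W" .
  have paths: "?A @ ?xs @ ?W \<in> paths P"
    unfolding left[symmetric] by (intro path_mult_path(1) assms)
  obtain A' where A': "?A = A' @ [?p \<otimes> ?t]"
    using ne(3) last_left_restrict[OF c(1), of ?t] by (metis append_butlast_last_id)
  obtain W' where W': "?W = (?s \<star> ?r) # W'"
    using c by (cases rs) auto
  obtain xs' where xs': "?xs = xs' @ [?s \<otimes> ?r]"
    using ne(1) lx by (metis append_butlast_last_id)
  obtain ys' where ys': "?ys = (?p \<star> ?t) # ys'"
    using ne(2) hy by (metis list.collapse)
  \<comment> \<open>The ends of the ladder: the corner \<open>last ?ys\<close> is inserted just before \<open>?W\<close>, and the corner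
    \<open>hd ?xs\<close> is removed just after \<open>?A\<close>.\<close>
  have right_end: "[?s \<otimes> ?r, ?s \<otimes> ?r, ?s \<star> ?r] \<approx> [?s \<otimes> ?r, last ?ys, ?s \<star> ?r]"
    using path_eq_triple[OF sc q(2,4)] belowD(5)[OF s] times_below_left[OF s q(4)] ly by simp
  have left_end: "[?p \<otimes> ?t, hd ?xs, ?p \<star> ?t] \<approx> [?p \<otimes> ?t, ?p \<star> ?t, ?p \<star> ?t]"
    using path_eq_triple[OF q(3,1) tc] belowD(3)[OF t] star_below_right[OF t q(3)] hx by simp
  have d: "?s \<otimes> ?r \<in> carrier P" "?p \<star> ?t \<in> carrier P" using sc tc q by auto
  have "[?s \<otimes> ?r, ?s \<star> ?r] \<approx> [?s \<otimes> ?r, ?s \<otimes> ?r, ?s \<star> ?r]"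
    using path_eq_context[OF path_eq_dup[OF d(1)], of "[]" "[?s \<star> ?r]"]
      path_eq_paths(1)[OF right_end] path_eq_sym by simp
  also note right_end
  finally have right_end': "[?s \<otimes> ?r, ?s \<star> ?r] \<approx> [?s \<otimes> ?r, last ?ys, ?s \<star> ?r]" .
  have left_end': "[?p \<otimes> ?t, hd ?xs, ?p \<star> ?t] \<approx> [?p \<otimes> ?t, ?p \<star> ?t]"
    using path_eq_trans[OF left_end] path_eq_context[OF path_eq_dup[OF d(2)], of "[?p \<otimes> ?t]" "[]"]
      path_eq_paths(2)[OF left_end] by simp
  have "?A @ ?xs @ ?W \<approx> ?A @ (?xs @ [last ?ys]) @ ?W"
    using path_eq_context[OF right_end', of "?A @ xs'" W'] paths xs' W' by simp
  also have "\<dots> \<approx> ?A @ (hd ?xs # ?ys) @ ?W"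
    using path_eq_context[OF ex] path_eq_paths(2)[OF calculation] by blast
  also have "\<dots> \<approx> ?A @ ?ys @ ?W"
    using path_eq_context[OF left_end', of A' "ys' @ ?W"] path_eq_paths(2)[OF calculation] ys' A'
    by simp
  finally show ?thesis unfolding left right .
qed

section \<open>The axioms of the chain semigroup\<close>

lemma right_restrict_hd: "ps \<in> paths P \<Longrightarrow> right_restrict P (hd ps) ps = ps"
proof (induction ps)
  case Nil then show ?case by simp
next
  case (Cons p ps)
  then have p: "p \<in> carrier P" by (simp add: paths_def)
  have "right_restrict P p ps = ps"
  proof (cases "ps = []")
    case False
    then have ps: "F_rel P p (hd ps)" "ps \<in> paths P" using Cons.prems by (auto simp: paths_Cons)
    have "right_restrict P p ps = right_restrict P (hd ps) ps"
      by (rule right_restrict_cong) (use ps pathsD(2)[OF ps(2)] in \<open>simp add: F_rel_def R1\<close>)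
    then show ?thesis using Cons.IH[OF ps(2)] by simp
  qed simp
  then show ?case by (simp add: R1 p)
qed

text \<open>Multiplying by a projection below the start only restricts the path: the link of the product is
  the trivial step \<open>(r, r)\<close>. The identity and restriction axioms all follow from this lemma and its
  mirror image.\<close>

lemma path_mult_below_hd:
  assumes "ps \<in> paths P" "r \<preceq> hd ps"
  shows "path_mult P [r] ps \<approx> right_restrict P r ps"
proof -
  note r = belowD[OF assms(2)]
  obtain us where us: "right_restrict P r ps = r # us"
    using pathsD(1)[OF assms(1)] r(5) by (cases ps) auto
  have "path_mult P [r] ps = [r, r] @ us"
    using us r by (simp add: path_mult_def)
  moreover have "[r, r] @ us \<in> paths P"
    using path_mult_path(1)[of "[r]" ps] assms(1) r(1) calculation by simp
  ultimately show ?thesis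
    using path_eq_context[OF path_eq_dup[OF r(1)], of "[]" us] us by simp
qed

lemma path_mult_below_last:
  assumes "ps \<in> paths P" "r \<preceq> last ps"
  shows "path_mult P ps [r] \<approx> left_restrict P ps r"
proof -
  note r = belowD[OF assms(2)]
  obtain us where us: "left_restrict P ps r = us @ [r]"
    using pathsD(1)[OF assms(1)] r(3) last_left_restrict[of ps r]
    by (metis append_butlast_last_id left_restrict_Nil)
  have "path_mult P ps [r] = us @ [r, r]"
    using us r by (simp add: path_mult_def)
  moreover have "us @ [r, r] \<in> paths P"
    using path_mult_path(1)[of ps "[r]"] assms(1) r(1) calculation by simp
  ultimately show ?thesis
    using path_eq_context[OF path_eq_dup[OF r(1)], of us "[]"] us by simp
qed

lemma path_mult_hd: 
  assumes "ps \<in> paths P"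
  shows "path_mult P [hd ps] ps \<approx> ps"
  using path_mult_below_hd[OF assms below_refl[OF pathsD(2)[OF assms]]] right_restrict_hd[OF assms]
  by simp

lemma path_mult_last: 
  assumes "ps \<in> paths P"
  shows "path_mult P ps [last ps] \<approx> ps"
proof -
  have "left_restrict P ps (last ps) = ps"
    using right_restrict_as_left[OF assms pathsD(2)[OF assms]]
    unfolding right_restrict_hd[OF assms] by simp
  then show ?thesis
    using path_mult_below_last[OF assms below_refl[OF pathsD(3)[OF assms]]] by simp
qed

text \<open>Both sides restrict \<open>xs\<close>, on the left at the end, on the right at the corresponding start.\<close>

lemma path_mult_restr_star:
  assumes "xs \<in> paths P" "ys \<in> paths P"
  shows "path_mult P xs [last (path_mult P ys xs)] \<approx> path_mult P [last (path_mult P ys [hd xs])] xs"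
proof -
  note c = pathsD[OF assms(1)] pathsD[OF assms(2)]
  let ?a = "last ys \<star> hd xs" and ?l = "last (right_restrict P (last ys) xs)"
  have "?l \<preceq> last xs" by (rule right_restrict_below[OF assms(1) c(7)])
  from path_mult_below_last[OF assms(1) this]
  have "path_mult P xs [?l] \<approx> right_restrict P (last ys) xs"
    unfolding right_restrict_as_left[OF assms(1) c(7), symmetric] .
  moreover have "right_restrict P (last ys) xs = right_restrict P ?a xs"
    by (rule right_restrict_cong) (use belowD(5)[OF below_star] c in simp)
  moreover have "right_restrict P ?a xs \<approx> path_mult P [?a] xs"
    by (rule path_eq_sym[OF path_mult_below_hd[OF assms(1) below_star[OF c(7,2)]]])
  ultimately have "path_mult P xs [?l] \<approx> path_mult P [?a] xs" using path_eq_trans by metis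
  then show ?thesis
    unfolding path_mult_path(3)[OF assms(2,1)] path_mult_def[of P ys "[hd xs]"] by simp
qed

lemma path_mult_restr_plus:
  assumes "xs \<in> paths P" "ys \<in> paths P"
  shows "path_mult P [hd (path_mult P xs ys)] xs \<approx> path_mult P xs [hd (path_mult P [last xs] ys)]"
proof -
  note c = pathsD[OF assms(1)] pathsD[OF assms(2)]
  let ?b = "last xs \<otimes> hd ys" and ?h = "hd (left_restrict P xs (hd ys))"
  have "?h \<preceq> hd xs" by (rule left_restrict_below[OF assms(1) c(6)])
  from path_mult_below_hd[OF assms(1) this]
  have "path_mult P [?h] xs \<approx> left_restrict P xs (hd ys)"
    unfolding left_restrict_as_right[OF assms(1) c(6), symmetric] .
  moreover have "left_restrict P xs (hd ys) = left_restrict P xs ?b"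
    by (rule left_restrict_cong) (use times_times_left c in simp)
  moreover have "left_restrict P xs ?b \<approx> path_mult P xs [?b]"
    by (rule path_eq_sym[OF path_mult_below_last[OF assms(1) below_times[OF c(3,6)]]])
  ultimately have "path_mult P [?h] xs \<approx> path_mult P xs [?b]" using path_eq_trans by metis
  then show ?thesis
    unfolding path_mult_path(2)[OF assms] path_mult_def[of P "[last xs]" ys] by simp
qed

lemma chain_class_eqI: "ps \<approx> qs \<Longrightarrow> chain_class P ps = chain_class P qs"
  unfolding chain_class_def path_eq_def by (rule equiv_class_eq[OF equiv_path_equiv])

lemma carrier_chain: "carrier (chain_semigroup P) = chain_class P ` paths P"
  by (auto simp: chain_semigroup_def chains_def quotient_def chain_class_def)

lemma mult_chain:
  assumes "ps \<in> paths P" "qs \<in> paths P"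
  shows "chain_class P ps \<cdot>\<^bsub>chain_semigroup P\<^esub> chain_class P qs = chain_class P (path_mult P ps qs)"
proof -
  have "(\<lambda>ps qs. chain_class P (path_mult P ps qs)) respects2 path_equiv P"
    by (rule congruent2I') (auto intro!: chain_class_eqI path_eq_path_mult simp: path_eq_def)
  from UN_equiv_class2[OF equiv_path_equiv equiv_path_equiv this assms] show ?thesis
    by (simp add: chain_semigroup_def chain_class_def)
qed

lemma plus_chain:
  assumes "ps \<in> paths P"
  shows "(chain_class P ps)\<^sup>\<oplus>\<^bsub>chain_semigroup P\<^esub> = chain_class P [hd ps]"
proof -
  have "(\<lambda>ps. chain_class P [hd ps]) respects path_equiv P"
    using path_eq_ends(1) by (auto intro!: congruentI simp: path_eq_def)
  from UN_equiv_class[OF equiv_path_equiv this assms] show ?thesis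
    by (simp add: chain_semigroup_def chain_class_def)
qed

lemma star_chain:
  assumes "ps \<in> paths P"
  shows "(chain_class P ps)\<^sup>\<star>\<^bsub>chain_semigroup P\<^esub> = chain_class P [last ps]"
proof -
  have "(\<lambda>ps. chain_class P [last ps]) respects path_equiv P"
    using path_eq_ends(2) by (auto intro!: congruentI simp: path_eq_def)
  from UN_equiv_class[OF equiv_path_equiv this assms] show ?thesis
    by (simp add: chain_semigroup_def chain_class_def)
qed

lemma drc_restriction_chain: "drc_restriction_semigroup (chain_semigroup P)"
proof -
  note ops = carrier_chain mult_chain plus_chain star_chain path_mult_path(1) pathsD(2,3)
  have hd_below: "hd (path_mult P ps qs) \<preceq> hd ps" if "ps \<in> paths P" "qs \<in> paths P" for ps qs
    unfolding path_mult_path(2)[OF that] by (rule left_restrict_below[OF that(1) pathsD(2)[OF that(2)]])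
  have last_below: "last (path_mult P ps qs) \<preceq> last qs" if "ps \<in> paths P" "qs \<in> paths P" for ps qs
    unfolding path_mult_path(3)[OF that] by (rule right_restrict_below[OF that(2) pathsD(3)[OF that(1)]])
  \<comment> \<open>Below \<open>p\<close>, multiplying by \<open>p\<close> on either side is trivial; this gives both absorption axioms.\<close>
  have conj: "chain_class P (path_mult P (path_mult P [p] [q]) [p]) = chain_class P [q]"
    if "q \<preceq> p" for p q
  proof (rule chain_class_eqI)
    note q = belowD[OF that]
    have "path_mult P [p] [q] \<approx> [q]" using path_mult_below_last[of "[p]" q] q that by simp
    then have "path_mult P (path_mult P [p] [q]) [p] \<approx> path_mult P [q] [p]"
      by (rule path_eq_path_mult) (use path_eq_refl q in simp)
    also have "\<dots> \<approx> [q]" using path_mult_below_hd[of "[p]" q] q that by simp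
    finally show "path_mult P (path_mult P [p] [q]) [p] \<approx> [q]" .
  qed
  show ?thesis
  proof ((unfold_locales; unfold carrier_chain; elim imageE), goal_cases)
    case (1 x y xs ys)
    then show ?case by (simp add: ops)
  next
    case (2 x xs)
    then show ?case by (simp add: ops)
  next
    case (3 x xs)
    then show ?case by (simp add: ops)
  next
    case (4 x y z xs ys zs)
    then show ?case by (simp add: ops chain_class_eqI path_mult_assoc)
  next
    case (5 x xs)
    then show ?case by (simp add: ops chain_class_eqI path_mult_hd)
  next
    case (6 x y xs ys)
    then show ?case by (simp add: ops path_mult_path(2))
  next
    case (7 x y xs ys)
    then show ?case using hd_below[of xs ys] by (simp add: ops conj belowD(1))
  next
    case (8 x xs)
    then show ?case by (simp add: ops)
  next
    case (9 x xs)
    then show ?case by (simp add: ops)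
  next
    case (10 x xs)
    then show ?case by (simp add: ops chain_class_eqI path_mult_last)
  next
    case (11 x y xs ys)
    then show ?case by (simp add: ops path_mult_path(3))
  next
    case (12 x y xs ys)
    then show ?case using last_below[of xs ys] by (simp add: ops conj belowD(1))
  next
    case (13 x xs)
    then show ?case by (simp add: ops)
  next
    case (14 x xs)
    then show ?case by (simp add: ops)
  next
    case (15 x y xs ys)
    then show ?case by (simp add: ops chain_class_eqI path_mult_restr_star)
  next
    case (16 x y xs ys)
    then show ?case by (simp add: ops chain_class_eqI path_mult_restr_plus)
  qed
qed

lemma projections_chain: "projections (chain_semigroup P) = {chain_class P [p] | p. p \<in> carrier P}"
proof -
  have "projections (chain_semigroup P) = (\<lambda>ps. chain_class P [hd ps]) ` paths P"
    by (auto simp: projections_def carrier_chain image_image plus_chain)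
  also have "\<dots> = {chain_class P [p] | p. p \<in> carrier P}"
  proof (intro equalityI subsetI)
    fix c assume "c \<in> {chain_class P [p] | p. p \<in> carrier P}"
    then obtain p where "c = chain_class P [hd [p]]" "[p] \<in> paths P" by auto
    then show "c \<in> (\<lambda>ps. chain_class P [hd ps]) ` paths P" by blast
  qed (use pathsD(2) in blast)
  finally show ?thesis .
qed

text \<open>A path is the product of its entries, since multiplying a path by a projection linked to its
  start just prepends that projection.\<close>

lemma projection_generated_chain: "projection_generated (chain_semigroup P)"
  unfolding projection_generated_def
proof
  interpret C: drc_restriction_semigroup "chain_semigroup P" by (rule drc_restriction_chain)
  let ?G = "generated_subsemigroup (chain_semigroup P) (projections (chain_semigroup P))"
  have "x \<in> carrier (chain_semigroup P)" if "x \<in> ?G" for x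
    using that by induction (auto simp: projections_def C.plus_closed C.mult_closed)
  then show "?G \<subseteq> carrier (chain_semigroup P)" by blast
  have "chain_class P ps \<in> ?G" if "ps \<in> paths P" for ps
    using that
  proof (induction ps)
    case Nil then show ?case by (simp add: paths_def)
  next
    case (Cons p ps)
    then have "p \<in> carrier P" by (simp add: paths_def)
    then have p: "chain_class P [p] \<in> ?G" "[p] \<in> paths P"
      by (auto simp: projections_chain intro: generated_subsemigroup.incl)
    show ?case
    proof (cases "ps = []")
      case False
      then have ps: "F_rel P p (hd ps)" "ps \<in> paths P" using Cons.prems by (auto simp: paths_Cons)
      have "right_restrict P p ps = right_restrict P (hd ps) ps"
        by (rule right_restrict_cong) (use ps pathsD(2)[OF ps(2)] in \<open>simp add: F_rel_def R1\<close>)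
      then have "path_mult P [p] ps = p # ps"
        using ps right_restrict_hd[OF ps(2)] by (simp add: path_mult_def F_rel_def)
      then show ?thesis
        using generated_subsemigroup.mult[OF p(1) Cons.IH[OF ps(2)]] mult_chain[OF p(2) ps(2)] by simp
    qed (use p in simp)
  qed
  then show "carrier (chain_semigroup P) \<subseteq> ?G" by (auto simp: carrier_chain)
qed

end

section \<open>Evaluating chains in a semigroup with the given projections\<close>

text \<open>Paths are nonempty, so the value on the empty list is left unspecified; \<open>S\<close> need not have an
  identity.\<close>

fun word_prod :: "'a drc_struct \<Rightarrow> 'a list \<Rightarrow> 'a" where
  "word_prod S [p] = p"
| "word_prod S (p # q # ps) = p \<cdot>\<^bsub>S\<^esub> word_prod S (q # ps)"

lemma word_prod_Cons: "ps \<noteq> [] \<Longrightarrow> word_prod S (p # ps) = p \<cdot>\<^bsub>S\<^esub> word_prod S ps"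
  by (cases ps) auto

locale projection_representation =
  strong_projection_algebra P + S: drc_semigroup S
  for P :: "'a proj_struct" (structure) and S :: "'a drc_struct" +
  assumes has_projection_algebra: "has_projection_algebra S P"
begin

abbreviation smult (infixl \<open>\<bullet>\<close> 70) where "x \<bullet> y \<equiv> x \<cdot>\<^bsub>S\<^esub> y"

lemma projectionD:
  assumes "p \<in> carrier P"
  shows "p \<in> carrier S" "p\<^sup>\<oplus>\<^bsub>S\<^esub> = p" "p\<^sup>\<star>\<^bsub>S\<^esub> = p" "p \<bullet> p = p"
proof -
  have "p \<in> plus_op S ` carrier S"
    using assms has_projection_algebra by (simp add: has_projection_algebra_def projections_def)
  then obtain x where x: "x \<in> carrier S" "p = x\<^sup>\<oplus>\<^bsub>S\<^esub>" by blast
  then show p: "p \<in> carrier S" "p\<^sup>\<oplus>\<^bsub>S\<^esub> = p" "p\<^sup>\<star>\<^bsub>S\<^esub> = p"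
    by (simp_all add: S.plus_closed S.plus_plus S.plus_star)
  then show "p \<bullet> p = p" using S.plus_mult[of p] by simp
qed

lemma ptimes_eq: "p \<in> carrier P \<Longrightarrow> q \<in> carrier P \<Longrightarrow> p \<otimes> q = (p \<bullet> q)\<^sup>\<oplus>\<^bsub>S\<^esub>"
  and pstar_eq: "p \<in> carrier P \<Longrightarrow> q \<in> carrier P \<Longrightarrow> p \<star> q = (p \<bullet> q)\<^sup>\<star>\<^bsub>S\<^esub>"
  using has_projection_algebra by (auto simp: has_projection_algebra_def)

text \<open>Since \<open>(p q)\<^sup>+\<close> lies below \<open>p\<close>, it absorbs the factor \<open>p\<close> in \<open>p q = (p q)\<^sup>+ p q\<close>.\<close>

lemma times_mult:
  assumes "p \<in> carrier P" "q \<in> carrier P"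
  shows "(p \<otimes> q) \<bullet> q = p \<bullet> q"
proof -
  note p = projectionD[OF assms(1)] and q = projectionD[OF assms(2)]
  have c: "p \<bullet> q \<in> carrier S" "p \<otimes> q \<in> carrier S"
    using p q S.mult_closed projectionD(1) ptimes_closed assms by auto
  have eq: "p \<otimes> q = p \<bullet> (p \<otimes> q) \<bullet> p"
    using S.plus_absorb[OF p(1) q(1)] p(2) ptimes_eq[OF assms] by simp
  have "(p \<otimes> q) \<bullet> p = p \<bullet> (p \<otimes> q) \<bullet> p \<bullet> p"
    by (rule arg_cong[OF eq])
  also have "\<dots> = p \<bullet> (p \<otimes> q) \<bullet> p"
    using S.mult_assoc[OF S.mult_closed[OF p(1) c(2)] p(1) p(1)] p(4) by simp
  finally have "(p \<otimes> q) \<bullet> p = p \<otimes> q" unfolding eq[symmetric] .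
  moreover have "(p \<otimes> q) \<bullet> (p \<bullet> q) = p \<bullet> q"
    using S.plus_mult[OF c(1)] ptimes_eq[OF assms] by simp
  ultimately show ?thesis using S.mult_assoc[OF c(2) p(1) q(1)] by simp
qed

lemma star_mult:
  assumes "p \<in> carrier P" "q \<in> carrier P"
  shows "p \<bullet> (p \<star> q) = p \<bullet> q"
proof -
  note p = projectionD[OF assms(1)] and q = projectionD[OF assms(2)]
  have c: "p \<bullet> q \<in> carrier S" "p \<star> q \<in> carrier S"
    using p q S.mult_closed projectionD(1) pstar_closed assms by auto
  have eq: "p \<star> q = q \<bullet> (p \<star> q) \<bullet> q"
    using S.star_absorb[OF p(1) q(1)] q(3) pstar_eq[OF assms] by simp
  have "q \<bullet> (p \<star> q) = q \<bullet> (q \<bullet> (p \<star> q) \<bullet> q)"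
    by (rule arg_cong[OF eq])
  also have "\<dots> = q \<bullet> (p \<star> q) \<bullet> q"
    using S.mult_assoc[OF q(1) S.mult_closed[OF q(1) c(2)] q(1)] S.mult_assoc[OF q(1) q(1) c(2)] q(4)
    by simp
  finally have "q \<bullet> (p \<star> q) = p \<star> q" unfolding eq[symmetric] .
  moreover have "(p \<bullet> q) \<bullet> (p \<star> q) = p \<bullet> q"
    using S.mult_star[OF c(1)] pstar_eq[OF assms] by simp
  ultimately show ?thesis using S.mult_assoc[OF p(1) q(1) c(2)] by simp
qed

lemma word_prod_closed:
  assumes "ps \<noteq> []" "set ps \<subseteq> carrier P"
  shows "word_prod S ps \<in> carrier S"
  using assms
  by (induction ps rule: list_nonempty_induct)
    (auto simp: word_prod_Cons projectionD(1) S.mult_closed)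

lemma word_prod_path: "ps \<in> paths P \<Longrightarrow> word_prod S ps \<in> carrier S"
  using word_prod_closed pathsD(1,4) by blast

lemma word_prod_append:
  assumes "ps \<noteq> []" "qs \<noteq> []" "set ps \<subseteq> carrier P" "set qs \<subseteq> carrier P"
  shows "word_prod S (ps @ qs) = word_prod S ps \<bullet> word_prod S qs"
  using assms
  by (induction ps rule: list_nonempty_induct)
    (auto simp: word_prod_Cons projectionD(1) word_prod_closed S.mult_assoc)

lemma hd_word_prod:
  assumes "ps \<in> paths P"
  shows "hd ps \<bullet> word_prod S ps = word_prod S ps"
proof (cases ps)
  case Nil then show ?thesis using pathsD(1)[OF assms] by simp
next
  case (Cons p qs)
  then have "p \<in> carrier P" "set qs \<subseteq> carrier P" using pathsD(4)[OF assms] by auto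
  then show ?thesis
    using Cons projectionD[of p]
    by (cases "qs = []") (auto simp: word_prod_Cons word_prod_closed simp flip: S.mult_assoc)
qed

lemma word_prod_last:
  assumes "ps \<in> paths P"
  shows "word_prod S ps \<bullet> last ps = word_prod S ps"
proof (cases ps rule: rev_cases)
  case Nil then show ?thesis using pathsD(1)[OF assms] by simp
next
  case (snoc qs p)
  then have "p \<in> carrier P" "set qs \<subseteq> carrier P" using pathsD(4)[OF assms] by auto
  then show ?thesis
    using snoc projectionD[of p]
    by (cases "qs = []") (auto simp: word_prod_append word_prod_closed S.mult_assoc)
qed

text \<open>Each entry is replaced by its restriction with \<open>p q = p (p \<star> q)\<close>, from left to right.\<close>

lemma word_prod_right_restrict:
  assumes "qs \<noteq> []" "set qs \<subseteq> carrier P" "p \<in> carrier P"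
  shows "set (right_restrict P p qs) \<subseteq> carrier P
    \<and> p \<bullet> word_prod S (right_restrict P p qs) = p \<bullet> word_prod S qs"
  using assms
proof (induction qs arbitrary: p rule: list_nonempty_induct)
  case (single q)
  then show ?case by (simp add: star_mult)
next
  case (cons q qs)
  let ?a = "p \<star> q" and ?w = "word_prod S qs" and ?v = "word_prod S (right_restrict P (p \<star> q) qs)"
  have c: "q \<in> carrier P" "set qs \<subseteq> carrier P" "?a \<in> carrier P" using cons.prems by auto
  note IH = cons.IH[OF c(2,3)]
  have w: "?w \<in> carrier S" "?v \<in> carrier S"
    using word_prod_closed cons.hyps c IH by auto
  note S = projectionD(1)[OF cons.prems(2)] projectionD(1)[OF c(1)] projectionD(1)[OF c(3)]
  have "p \<bullet> (q \<bullet> ?w) = (p \<bullet> ?a) \<bullet> ?w"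
    using star_mult[OF cons.prems(2) c(1)] S.mult_assoc[OF S(1,2) w(1)] by simp
  also have "\<dots> = p \<bullet> (?a \<bullet> ?v)"
    using IH S.mult_assoc[OF S(1,3) w(1)] by simp
  finally show ?case
    using cons.hyps IH c by (simp add: word_prod_Cons)
qed

lemma word_prod_left_restrict:
  assumes "ps \<in> paths P" "q \<in> carrier P"
  shows "word_prod S (left_restrict P ps q) \<bullet> q = word_prod S ps \<bullet> q"
  using assms(1)
proof (induction ps)
  case Nil then show ?case by (simp add: paths_def)
next
  case (Cons p ps)
  show ?case
  proof (cases "ps = []")
    case True
    then show ?thesis using Cons.prems assms(2) by (simp add: times_mult)
  next
    case False
    then have p: "p \<in> carrier P" "ps \<in> paths P" using Cons.prems by (auto simp: paths_Cons)
    let ?L = "left_restrict P ps q"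
    let ?h = "hd ?L" and ?v = "word_prod S ?L" and ?w = "word_prod S ps"
    have L: "?L \<in> paths P" by (rule left_restrict_paths[OF p(2) assms(2)])
    note h = pathsD(2)[OF L]
    have S: "p \<in> carrier S" "?h \<in> carrier S" "p \<otimes> ?h \<in> carrier S" "q \<in> carrier S"
      using projectionD(1) p h assms(2) by auto
    have w: "?w \<in> carrier S" "?v \<in> carrier S" using word_prod_path p L by auto
    have "(p \<otimes> ?h) \<bullet> ?v = p \<bullet> ?v"
      using hd_word_prod[OF L] times_mult[OF p(1) h] S.mult_assoc[OF S(3,2) w(2)]
        S.mult_assoc[OF S(1,2) w(2)] by simp
    then show ?thesis
      using Cons.IH[OF p(2)] False S.mult_assoc[OF S(1) w(1) S(4)] S.mult_assoc[OF S(1) w(2) S(4)]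
      by (simp add: word_prod_Cons hd_append)
  qed
qed

text \<open>The inner endpoints are idempotent, so copies of them can be inserted between the two words;
  next to such a copy, each word may be replaced by the restricted one.\<close>

lemma word_prod_path_mult:
  assumes "ps \<in> paths P" "qs \<in> paths P"
  shows "word_prod S (path_mult P ps qs) = word_prod S ps \<bullet> word_prod S qs"
proof -
  note c = pathsD[OF assms(1)] pathsD[OF assms(2)]
  let ?q = "hd qs" and ?p = "last ps"
  let ?L = "left_restrict P ps ?q" and ?R = "right_restrict P ?p qs"
  have L: "?L \<in> paths P" by (rule left_restrict_paths[OF assms(1) c(6)])
  have R: "?R \<in> paths P" by (rule right_restrict_paths[OF assms(2) c(3)])
  have l: "last ?L = ?p \<otimes> ?q" using c by (simp add: last_left_restrict)
  note S = word_prod_path[OF assms(1)] word_prod_path[OF assms(2)] word_prod_path[OF L]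
    word_prod_path[OF R] projectionD(1)[OF c(6)] projectionD(1)[OF pathsD(3)[OF L]]
  have "right_restrict P (last ?L) qs = ?R"
    unfolding l by (rule right_restrict_cong) (use c in \<open>simp add: star_times_absorb\<close>)
  then have R': "last ?L \<bullet> word_prod S ?R = last ?L \<bullet> word_prod S qs"
    using word_prod_right_restrict[OF c(5,8) pathsD(3)[OF L]] by simp
  have "word_prod S ps \<bullet> word_prod S qs = (word_prod S ps \<bullet> ?q) \<bullet> word_prod S qs"
    using hd_word_prod[OF assms(2)] S.mult_assoc[OF S(1,5,2)] by simp
  also have "\<dots> = word_prod S ?L \<bullet> word_prod S qs"
    unfolding word_prod_left_restrict[OF assms(1) c(6), symmetric]
    using hd_word_prod[OF assms(2)] S.mult_assoc[OF S(3,5,2)] by simp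
  also have "\<dots> = word_prod S ?L \<bullet> (last ?L \<bullet> word_prod S qs)"
    using word_prod_last[OF L] S.mult_assoc[OF S(3,6,2)] by simp
  also have "\<dots> = word_prod S ?L \<bullet> word_prod S ?R"
    unfolding R'[symmetric] using word_prod_last[OF L] S.mult_assoc[OF S(3,6,4)] by simp
  also have "\<dots> = word_prod S (path_mult P ps qs)"
    unfolding path_mult_def
    by (rule word_prod_append[symmetric]) (use pathsD[OF L] pathsD[OF R] in auto)
  finally show ?thesis ..
qed

lemma word_prod_path_comp:
  assumes "ps \<in> paths P" "qs \<in> paths P" "last ps = hd qs"
  shows "word_prod S (ps \<circ>\<^sub>p qs) = word_prod S ps \<bullet> word_prod S qs"
proof -
  obtain q us where q: "qs = q # us" using pathsD(1)[OF assms(2)] by (cases qs) auto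
  note c = pathsD[OF assms(1)] pathsD[OF assms(2)]
  show ?thesis
  proof (cases "us = []")
    case True
    then show ?thesis using q assms word_prod_last[OF assms(1)] by (simp add: path_comp_def)
  next
    case False
    have us: "set us \<subseteq> carrier P" "q \<in> carrier P" using c q by auto
    have "word_prod S ps \<bullet> word_prod S us = (word_prod S ps \<bullet> q) \<bullet> word_prod S us"
      using word_prod_last[OF assms(1)] assms(3) q by simp
    also have "\<dots> = word_prod S ps \<bullet> word_prod S qs"
      using q False us S.mult_assoc[OF word_prod_path[OF assms(1)] projectionD(1) word_prod_closed]
      by (simp add: word_prod_Cons)
    finally show ?thesis
      using q False us c by (simp add: path_comp_def word_prod_append)
  qed
qed

lemma plus_word_prod:
  assumes "ps \<in> paths P"
  shows "(word_prod S ps)\<^sup>\<oplus>\<^bsub>S\<^esub> = hd ps"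
  using assms
proof (induction ps)
  case Nil then show ?case by (simp add: paths_def)
next
  case (Cons p ps)
  show ?case
  proof (cases "ps = []")
    case True then show ?thesis using Cons.prems by (simp add: projectionD)
  next
    case False
    then have p: "p \<in> carrier P" "F_rel P p (hd ps)" "ps \<in> paths P"
      using Cons.prems by (auto simp: paths_Cons)
    have "(word_prod S (p # ps))\<^sup>\<oplus>\<^bsub>S\<^esub> = (p \<bullet> hd ps)\<^sup>\<oplus>\<^bsub>S\<^esub>"
      using S.plus_right[OF projectionD(1)[OF p(1)] word_prod_path[OF p(3)]] Cons.IH[OF p(3)] False
      by (simp add: word_prod_Cons)
    also have "\<dots> = p" using ptimes_eq[OF p(1) pathsD(2)[OF p(3)]] p(2) by (simp add: F_rel_def)
    finally show ?thesis by simp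
  qed
qed

lemma star_mult_word_prod:
  assumes "qs \<noteq> []" "set qs \<subseteq> carrier P" "p \<in> carrier P"
  shows "(p \<bullet> word_prod S qs)\<^sup>\<star>\<^bsub>S\<^esub> = last (right_restrict P p qs)"
  using assms
proof (induction qs arbitrary: p rule: list_nonempty_induct)
  case (single q)
  then show ?case by (simp add: pstar_eq)
next
  case (cons q qs)
  then have c: "q \<in> carrier P" "set qs \<subseteq> carrier P" by auto
  note S = projectionD(1)[OF cons.prems(2)] projectionD(1)[OF c(1)] word_prod_closed[OF cons.hyps c(2)]
  have "(p \<bullet> word_prod S (q # qs))\<^sup>\<star>\<^bsub>S\<^esub> = ((p \<star> q) \<bullet> word_prod S qs)\<^sup>\<star>\<^bsub>S\<^esub>"
    using S.star_left[OF S.mult_closed[OF S(1,2)] S(3)] S.mult_assoc[OF S] cons.hyps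
    by (simp add: word_prod_Cons pstar_eq[OF cons.prems(2) c(1)])
  then show ?case using cons.IH[OF c(2)] cons.hyps c cons.prems by simp
qed

lemma star_word_prod:
  assumes "ps \<in> paths P"
  shows "(word_prod S ps)\<^sup>\<star>\<^bsub>S\<^esub> = last ps"
  using star_mult_word_prod[OF pathsD(1,4,2)[OF assms]] hd_word_prod[OF assms]
    right_restrict_hd[OF assms] by simp

text \<open>Both sides of the generating pair of an admissible triple \<open>(e, p, f)\<close> evaluate to \<open>e p f\<close>.\<close>

lemma word_prod_path_eq:
  assumes "ps \<approx> qs"
  shows "word_prod S ps = word_prod S qs"
proof -
  let ?R = "{(ps, qs). ps \<approx> qs \<and> word_prod S ps = word_prod S qs}"
  have "path_congruence P ?R"
  proof (rule path_congruenceI)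
    show "equiv (paths P) ?R"
    proof (rule equivI)
      show "?R \<subseteq> paths P \<times> paths P" using path_eq_paths by auto
      show "refl_on (paths P) ?R" by (rule refl_onI) (simp add: path_eq_refl)
      show "sym ?R" by (rule symI) (simp add: path_eq_sym)
      show "trans ?R" by (rule transI) (simp, meson path_eq_trans)
    qed
  next
    fix ps qs assume "(ps, qs) \<in> ?R"
    then show "hd ps = hd qs \<and> last ps = last qs" using path_eq_ends by auto
  next
    fix ps qs us assume *: "(ps, qs) \<in> ?R" and us: "us \<in> paths P" "last us = hd ps"
    then have "ps \<approx> qs" by simp
    note this path_eq_paths[OF this] path_eq_ends[OF this]
    then show "(us \<circ>\<^sub>p ps, us \<circ>\<^sub>p qs) \<in> ?R"
      using * us path_eq_comp[OF path_eq_refl[OF us(1)]] by (simp add: word_prod_path_comp)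
  next
    fix ps qs us assume *: "(ps, qs) \<in> ?R" and us: "us \<in> paths P" "last ps = hd us"
    then have "ps \<approx> qs" by simp
    note this path_eq_paths[OF this] path_eq_ends[OF this]
    then show "(ps \<circ>\<^sub>p us, qs \<circ>\<^sub>p us) \<in> ?R"
      using * us path_eq_comp[OF _ path_eq_refl[OF us(1)]] by (simp add: word_prod_path_comp)
  next
    fix p assume "p \<in> carrier P"
    then show "([p, p], [p]) \<in> ?R" by (simp add: path_eq_dup projectionD)
  next
    fix e p f assume a: "admissible P e p f"
    then have c: "e \<in> carrier P" "p \<in> carrier P" "f \<in> carrier P" by (auto simp: admissible_def)
    note S = projectionD(1)[OF c(1)] projectionD(1)[OF c(2)] projectionD(1)[OF c(3)]
    have "e \<bullet> ((e \<star> p) \<bullet> f) = (e \<bullet> p) \<bullet> f"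
      using S.mult_assoc[OF S(1) projectionD(1) S(3), of "e \<star> p"] star_mult c by simp
    also have "\<dots> = e \<bullet> ((p \<otimes> f) \<bullet> f)"
      using S.mult_assoc[OF S] times_mult c by simp
    finally show "([e, e \<star> p, f], [e, p \<otimes> f, f]) \<in> ?R"
      using path_eq_admissible[OF a] by simp
  qed
  from path_equiv_least[OF this assms[unfolded path_eq_def]] show ?thesis by blast
qed

definition chain_eval :: "'a list set \<Rightarrow> 'a" where
  "chain_eval c = word_prod S (SOME ps. ps \<in> c)"

lemma chain_eval_class:
  assumes "ps \<in> paths P"
  shows "chain_eval (chain_class P ps) = word_prod S ps"
proof -
  have "ps \<in> chain_class P ps"
    using path_eq_refl[OF assms] by (simp add: chain_class_def path_eq_def)
  then have "(SOME qs. qs \<in> chain_class P ps) \<in> chain_class P ps" by (rule someI)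
  then have "ps \<approx> (SOME qs. qs \<in> chain_class P ps)"
    by (simp add: chain_class_def path_eq_def)
  then show ?thesis unfolding chain_eval_def by (rule word_prod_path_eq[symmetric])
qed

lemma chain_eval_hom: "chain_eval \<in> drc_hom (chain_semigroup P) S"
  unfolding drc_hom_def carrier_chain
  by (auto simp: chain_eval_class word_prod_path mult_chain path_mult_path(1) word_prod_path_mult
      plus_chain plus_word_prod star_chain star_word_prod pathsD(2,3))

lemma chain_eval_surj:
  assumes "projection_generated S"
  shows "chain_eval ` carrier (chain_semigroup P) = carrier S"
proof
  interpret C: drc_restriction_semigroup "chain_semigroup P" by (rule drc_restriction_chain)
  show "chain_eval ` carrier (chain_semigroup P) \<subseteq> carrier S"
    using chain_eval_hom by (auto simp: drc_hom_def)
  have "x \<in> chain_eval ` carrier (chain_semigroup P)"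
    if "x \<in> generated_subsemigroup S (projections S)" for x
    using that
  proof induction
    case (incl x)
    then have x: "[x] \<in> paths P"
      using has_projection_algebra by (simp add: has_projection_algebra_def)
    then have "x = chain_eval (chain_class P [x])" by (simp add: chain_eval_class)
    with x show ?case unfolding carrier_chain by blast
  next
    case (mult x y)
    then obtain c d where "c \<in> carrier (chain_semigroup P)" "d \<in> carrier (chain_semigroup P)"
      "x = chain_eval c" "y = chain_eval d" by blast
    then have "x \<bullet> y = chain_eval (c \<cdot>\<^bsub>chain_semigroup P\<^esub> d)"
      "c \<cdot>\<^bsub>chain_semigroup P\<^esub> d \<in> carrier (chain_semigroup P)"
      using chain_eval_hom C.mult_closed[of c d] by (simp_all add: drc_hom_def)
    then show ?case by (rule image_eqI)
  qed
  then show "carrier S \<subseteq> chain_eval ` carrier (chain_semigroup P)"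
    using assms by (auto simp: projection_generated_def)
qed

end

section \<open>The universal property of the chain semigroup\<close>

theorem theorem7p12:
  fixes P :: "'a proj_struct"
  assumes "strong_projection_algebra P"
  shows "drc_restriction_semigroup (chain_semigroup P)
      \<and> projection_generated (chain_semigroup P)
      \<and> projections (chain_semigroup P) = {chain_class P [p] | p. p \<in> carrier P}
      \<and> (\<forall>S :: 'a drc_struct.
           drc_restriction_semigroup S \<and> projection_generated S \<and> has_projection_algebra S P
           \<longrightarrow> (\<exists>\<phi> \<in> drc_hom (chain_semigroup P) S.
                 \<phi> ` carrier (chain_semigroup P) = carrier S
                 \<and> (\<forall>p \<in> carrier P. \<phi> (chain_class P [p]) = p)))"
proof -
  interpret strong_projection_algebra P by (rule assms)
  have "\<exists>\<phi> \<in> drc_hom (chain_semigroup P) S. \<phi> ` carrier (chain_semigroup P) = carrier S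
      \<and> (\<forall>p \<in> carrier P. \<phi> (chain_class P [p]) = p)"
    if S: "drc_restriction_semigroup S" "projection_generated S" "has_projection_algebra S P"
    for S :: "'a drc_struct"
  proof -
    interpret S: drc_restriction_semigroup S by (rule S)
    interpret projection_representation P S by unfold_locales (rule S)
    have "\<forall>p \<in> carrier P. chain_eval (chain_class P [p]) = p" by (simp add: chain_eval_class)
    then show ?thesis using chain_eval_hom chain_eval_surj[OF S(2)] by blast
  qed
  then show ?thesis
    using drc_restriction_chain projection_generated_chain projections_chain by blast
qed

end
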